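(* Let $G$ be an open subgroup of $\operatorname{SL}_2(\mathbb{Z}_2)^2$ whose reduction modulo $4$ is trivial. Denote by $G_1,G_2$ the two projections of $G$ on the factors $\operatorname{SL}_2(\mathbb{Z}_2)$, and for $i=1,2$ let $n_i\geq 3$ be an integer such that $G_i$ contains $\mathcal{B}_2(n_i)$. If $\mathcal{L}(G)$ contains $2^k\mathfrak{sl}_2(\mathbb{Z}_2)\oplus 2^k\mathfrak{sl}_2(\mathbb{Z}_2)$ for a certain integer $k\geq 2$, then $G$ contains $$\mathcal{B}_2\big(6(k+11n_2+5n_1+12),\;6(k+11n_1+5n_2+12)\big).$$
   Context: For a positive integer $s$, $\mathcal{B}_2(s)=\{x\in \operatorname{SL}_2(\mathbb{Z}_2) : x\equiv \operatorname{Id} \pmod{2^s}\}$, and $\mathcal{B}_2(k_1,k_2)=\mathcal{B}_2(k_1)\times\mathcal{B}_2(k_2)$. "Reduction modulo $4$ is trivial" means that every element of $G$ is congruent to $(\operatorname{Id},\operatorname{Id})$ modulo $4$. $\mathfrak{sl}_2(\mathbb{Z}_2)$ is the set of trace-zero $2\times2$ matrices over $\mathbb{Z}_2$. For a subgroup $G$ of $\operatorname{SL}_2(\mathbb{Z}_2)^2$ that is trivial modulo $4$, $\mathcal{L}(G)\subseteq\mathfrak{sl}_2(\mathbb{Z}_2)^2$ is the $\mathbb{Z}_2$-span of $\Theta_2(G)$, where $\Theta_2(g_1,g_2)=\left(g_1-\tfrac12\operatorname{tr}(g_1)\operatorname{Id},\,g_2-\tfrac12\operatorname{tr}(g_2)\operatorname{Id}\right)$.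 *)

theory Defs
  imports "HOL-Analysis.Analysis" "HOL-Algebra.Group"
begin

section \<open>The ring of 2-adic integers\<close>

text \<open>
  The inverse limit of the rings \<open>\<int>/2\<^sup>n\<int>\<close>; the residue classes are represented by
  the integers in \<open>{0..<2^n}\<close>.
\<close>

typedef zadic2 =
  "{x :: nat \<Rightarrow> int. \<forall>n. x n \<in> {0..<2 ^ n} \<and> x (Suc n) mod 2 ^ n = x n}"
  morphisms residue Abs_zadic2
  by (rule exI[of _ "\<lambda>_. 0"]) auto

setup_lifting type_definition_zadic2

lemma mod_pow2_Suc: "(a :: int) mod 2 ^ Suc n mod 2 ^ n = a mod 2 ^ n"
  by (rule mod_mod_cancel) (rule le_imp_power_dvd, simp)

lemma residue_mod [simp]: "residue x n mod 2 ^ n = residue x n"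
  using residue[of x] by simp

lemma residue_nonneg: "residue x n \<ge> 0" and residue_less: "residue x n < 2 ^ n"
  using residue[of x] by simp_all

lemma residue_0 [simp]: "residue x 0 = 0"
  using residue_mod[of x 0] by simp

lemma residue_mod_le: "m \<le> n \<Longrightarrow> residue x n mod 2 ^ m = residue x m"
proof (induction n rule: dec_induct)
  case base
  show ?case by simp
next
  case (step n)
  have "residue x (Suc n) mod 2 ^ m = residue x (Suc n) mod 2 ^ n mod 2 ^ m"
    by (rule mod_mod_cancel[symmetric]) (rule le_imp_power_dvd, rule step.hyps)
  also have "residue x (Suc n) mod 2 ^ n = residue x n"
    using residue[of x] by simp
  finally show ?case using step.IH by simp
qed

instantiation zadic2 :: comm_ring_1
begin

lift_definition zero_zadic2 :: zadic2 is "\<lambda>_. 0" by simp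

lift_definition one_zadic2 :: zadic2 is "\<lambda>n. 1 mod 2 ^ n"
  by (auto simp: mod_pow2_Suc simp del: power_Suc)

lift_definition plus_zadic2 :: "zadic2 \<Rightarrow> zadic2 \<Rightarrow> zadic2"
  is "\<lambda>x y n. (x n + y n) mod 2 ^ n"
  by (auto simp: mod_pow2_Suc simp del: power_Suc) (metis mod_add_eq)

lift_definition minus_zadic2 :: "zadic2 \<Rightarrow> zadic2 \<Rightarrow> zadic2"
  is "\<lambda>x y n. (x n - y n) mod 2 ^ n"
  by (auto simp: mod_pow2_Suc simp del: power_Suc) (metis mod_diff_eq)

lift_definition uminus_zadic2 :: "zadic2 \<Rightarrow> zadic2"
  is "\<lambda>x n. (- x n) mod 2 ^ n"
  by (auto simp: mod_pow2_Suc simp del: power_Suc) (metis mod_minus_eq)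

lift_definition times_zadic2 :: "zadic2 \<Rightarrow> zadic2 \<Rightarrow> zadic2"
  is "\<lambda>x y n. (x n * y n) mod 2 ^ n"
  by (auto simp: mod_pow2_Suc simp del: power_Suc) (metis mod_mult_eq)

instance
proof
  fix a b c :: zadic2
  show "a + b + c = a + (b + c)"
    by transfer (auto simp: fun_eq_iff mod_simps algebra_simps)
  show "a + b = b + a"
    by transfer (auto simp: fun_eq_iff algebra_simps)
  show "0 + a = a"
    by transfer (auto simp: fun_eq_iff)
  show "- a + a = 0"
    by transfer (auto simp: fun_eq_iff mod_simps)
  show "a - b = a + - b"
    by transfer (auto simp: fun_eq_iff mod_simps)
  show "a * b * c = a * (b * c)"
    by transfer (auto simp: fun_eq_iff mod_simps algebra_simps)
  show "a * b = b * a"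
    by transfer (auto simp: fun_eq_iff algebra_simps)
  show "1 * a = a"
    by (rule residue_inject[THEN iffD1])
      (simp add: times_zadic2.rep_eq one_zadic2.rep_eq mod_simps fun_eq_iff)
  show "(a + b) * c = a * c + b * c"
    by transfer (auto simp: fun_eq_iff mod_simps algebra_simps)
  show "(0 :: zadic2) \<noteq> 1"
    by transfer (auto simp: fun_eq_iff intro!: exI[of _ 1])
qed

end

lemma residue_of_nat: "residue (of_nat m) n = int m mod 2 ^ n"
  by (induction m)
    (simp_all add: zero_zadic2.rep_eq one_zadic2.rep_eq plus_zadic2.rep_eq mod_simps)

lemma residue_pow2: "residue (2 ^ m) n = 2 ^ m mod 2 ^ n"
  using residue_of_nat[of "2 ^ m" n] by simp

lemma pow2_dvd_zadic2_iff: "2 ^ n dvd x \<longleftrightarrow> residue x n = 0"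
proof
  assume "2 ^ n dvd x"
  then obtain y where "x = 2 ^ n * y" ..
  then show "residue x n = 0"
    by (simp add: times_zadic2.rep_eq residue_pow2)
next
  assume x: "residue x n = 0"
  define y where "y m = residue x (m + n) div 2 ^ n" for m
  have xy: "residue x (m + n) = 2 ^ n * y m" for m
  proof -
    have "residue x (m + n) mod 2 ^ n = 0"
      using x by (simp add: residue_mod_le)
    then have "2 ^ n dvd residue x (m + n)" by (simp add: dvd_eq_mod_eq_0)
    then show ?thesis by (simp add: y_def)
  qed
  have range: "y m \<in> {0..<2 ^ m}" for m
  proof -
    have "0 \<le> 2 ^ n * y m"
      using residue_nonneg[of x "m + n"] by (simp only: xy)
    moreover have "2 ^ n * y m < 2 ^ n * 2 ^ m"
      using residue_less[of x "m + n"] by (simp only: xy power_add mult.commute)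
    ultimately show ?thesis by (simp add: zero_le_mult_iff)
  qed
  have "y (Suc m) mod 2 ^ m = y m" for m
  proof -
    have "2 ^ n * (y (Suc m) mod 2 ^ m) = (2 ^ n * y (Suc m)) mod 2 ^ (m + n)"
      by (simp only: mult_mod_right power_add mult.commute[of "2 ^ m"])
    also have "\<dots> = 2 ^ n * y m"
      unfolding xy[symmetric] by (rule residue_mod_le) simp
    finally show ?thesis by simp
  qed
  with range have y: "residue (Abs_zadic2 y) = y"
    by (intro Abs_zadic2_inverse) simp
  have "residue x m = (2 ^ n * y m) mod 2 ^ m" for m
    unfolding xy[symmetric] by (rule residue_mod_le[symmetric]) simp
  then have "x = 2 ^ n * Abs_zadic2 y"
    by (intro residue_inject[THEN iffD1] ext)
      (simp add: times_zadic2.rep_eq residue_pow2 y mod_simps)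
  then show "2 ^ n dvd x" ..
qed

lemma zadic2_no_zero_divisors:
  fixes x y :: zadic2
  assumes "x \<noteq> 0" "y \<noteq> 0"
  shows "x * y \<noteq> 0"
proof
  assume xy: "x * y = 0"
  obtain a where a: "residue x a \<noteq> 0"
    using assms(1) by (metis residue_inject zero_zadic2.rep_eq ext)
  obtain b where b: "residue y b \<noteq> 0"
    using assms(2) by (metis residue_inject zero_zadic2.rep_eq ext)
  define X Y where "X = residue x (a + b)" and "Y = residue y (a + b)"
  have "X mod 2 ^ a \<noteq> 0" "Y mod 2 ^ b \<noteq> 0"
    using a b by (simp_all add: X_def Y_def residue_mod_le)
  then have ndvd: "\<not> 2 ^ a dvd X" "\<not> 2 ^ b dvd Y" by auto
  then have nz: "X \<noteq> 0" "Y \<noteq> 0" by auto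
  have "multiplicity 2 X < a" "multiplicity 2 Y < b"
    using ndvd nz by (simp_all add: power_dvd_iff_le_multiplicity)
  then have "multiplicity 2 (X * Y) < a + b"
    using nz by (simp add: prime_elem_multiplicity_mult_distrib)
  then have "\<not> 2 ^ (a + b) dvd X * Y"
    using nz by (simp add: power_dvd_iff_le_multiplicity)
  moreover have "(X * Y) mod 2 ^ (a + b) = 0"
    using xy by (metis X_def Y_def times_zadic2.rep_eq zero_zadic2.rep_eq)
  ultimately show False by auto
qed

text \<open>
  \<open>x div y\<close> is the exact quotient if \<open>y\<close> is nonzero and divides \<open>x\<close>, and is otherwise
  unspecified (\<open>0\<close> if \<open>y = 0\<close>).
\<close>

instantiation zadic2 :: divide
begin

definition divide_zadic2 :: "zadic2 \<Rightarrow> zadic2 \<Rightarrow> zadic2" where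
  "divide_zadic2 x y = (if y = 0 then 0 else (THE q. q * y = x))"

instance ..

end

instance zadic2 :: idom_divide
proof
  fix x y :: zadic2
  show "x \<noteq> 0 \<Longrightarrow> y \<noteq> 0 \<Longrightarrow> x * y \<noteq> 0"
    by (rule zadic2_no_zero_divisors)
  show "x div 0 = 0"
    by (simp add: divide_zadic2_def)
  assume y: "y \<noteq> 0"
  have "q = x" if "q * y = x * y" for q
  proof -
    have "(q - x) * y = 0" using that by (simp add: algebra_simps)
    then show ?thesis using y zadic2_no_zero_divisors[of "q - x" y] by auto
  qed
  then show "x * y div y = x"
    using y by (auto simp: divide_zadic2_def intro!: the_equality)
qed

text \<open>
  The 2-adic topology: the cosets of the ideals \<open>2\<^sup>n\<int>\<^sub>2\<close> form a basis.
\<close>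

instantiation zadic2 :: topological_space
begin

definition open_zadic2 :: "zadic2 set \<Rightarrow> bool" where
  "open_zadic2 U \<longleftrightarrow> (\<forall>x\<in>U. \<exists>n. \<forall>y. 2 ^ n dvd y - x \<longrightarrow> y \<in> U)"

instance
proof
  show "open (UNIV :: zadic2 set)"
    by (simp add: open_zadic2_def)
next
  fix S T :: "zadic2 set"
  assume S: "open S" and T: "open T"
  show "open (S \<inter> T)"
    unfolding open_zadic2_def
  proof
    fix x assume x: "x \<in> S \<inter> T"
    obtain m where m: "\<And>y. 2 ^ m dvd y - x \<Longrightarrow> y \<in> S"
      using S x unfolding open_zadic2_def by blast
    obtain n where n: "\<And>y. 2 ^ n dvd y - x \<Longrightarrow> y \<in> T"
      using T x unfolding open_zadic2_def by blast
    have "y \<in> S \<inter> T" if "2 ^ max m n dvd y - x" for y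
      using m n that by (meson IntI dvd_trans le_imp_power_dvd max.cobounded1 max.cobounded2)
    then show "\<exists>n. \<forall>y. 2 ^ n dvd y - x \<longrightarrow> y \<in> S \<inter> T" by blast
  qed
next
  fix K :: "zadic2 set set"
  assume K: "\<forall>S\<in>K. open S"
  show "open (\<Union>K)"
    unfolding open_zadic2_def
  proof
    fix x assume "x \<in> \<Union>K"
    then obtain S where S: "S \<in> K" "x \<in> S" by blast
    then obtain n where "\<forall>y. 2 ^ n dvd y - x \<longrightarrow> y \<in> S"
      using K unfolding open_zadic2_def by blast
    then show "\<exists>n. \<forall>y. 2 ^ n dvd y - x \<longrightarrow> y \<in> \<Union>K"
      using S by blast
  qed
qed

end

section \<open>The special linear group and its congruence subgroups\<close>

type_synonym mat2 = "zadic2 ^ 2 ^ 2"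

definition SL2 :: "mat2 monoid" where
  "SL2 = \<lparr>carrier = {g. det g = 1}, mult = (**), one = mat 1\<rparr>"

definition mat2_cong :: "zadic2 \<Rightarrow> mat2 \<Rightarrow> mat2 \<Rightarrow> bool" where
  "mat2_cong m A B \<longleftrightarrow> (\<forall>i j. m dvd A $ i $ j - B $ i $ j)"

definition cong_subgroup :: "nat \<Rightarrow> mat2 set" where
  "cong_subgroup s = {g \<in> carrier SL2. mat2_cong (2 ^ s) g (mat 1)}"

definition cong_subgroup2 :: "nat \<Rightarrow> nat \<Rightarrow> (mat2 \<times> mat2) set" where
  "cong_subgroup2 k1 k2 = cong_subgroup k1 \<times> cong_subgroup k2"

definition trivial_mod4 :: "(mat2 \<times> mat2) set \<Rightarrow> bool" where
  "trivial_mod4 G \<longleftrightarrow> (\<forall>(g1, g2)\<in>G. mat2_cong 4 g1 (mat 1) \<and> mat2_cong 4 g2 (mat 1))"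

lemma group_SL2: "group SL2"
proof (rule groupI)
  fix x assume "x \<in> carrier SL2"
  then have d: "x $ 1 $ 1 * x $ 2 $ 2 - x $ 1 $ 2 * x $ 2 $ 1 = 1"
    by (simp add: SL2_def det_2)
  define y :: mat2 where
    "y = vector [vector [x $ 2 $ 2, - x $ 1 $ 2], vector [- x $ 2 $ 1, x $ 1 $ 1]]"
  have "det y = 1"
    using d by (simp add: y_def det_2 vector_2 algebra_simps)
  moreover have "y ** x = mat 1"
    using d by (simp add: y_def matrix_matrix_mult_def mat_def vec_eq_iff forall_2 sum_2
        vector_2 algebra_simps)
  ultimately show "\<exists>y\<in>carrier SL2. y \<otimes>\<^bsub>SL2\<^esub> x = \<one>\<^bsub>SL2\<^esub>"
    by (auto simp: SL2_def)
qed (auto simp: SL2_def det_mul matrix_mul_assoc)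

section \<open>The Lie algebra attached to a subgroup\<close>

definition mat2_scale :: "zadic2 \<Rightarrow> mat2 \<Rightarrow> mat2" where
  "mat2_scale c A = (\<chi> i j. c * A $ i $ j)"

definition sl2 :: "mat2 set" where
  "sl2 = {A. trace A = 0}"

definition pair_scale :: "zadic2 \<Rightarrow> mat2 \<times> mat2 \<Rightarrow> mat2 \<times> mat2" where
  "pair_scale c = map_prod (mat2_scale c) (mat2_scale c)"

lemma module_pair_scale: "module pair_scale"
  by unfold_locales
    (auto simp: pair_scale_def mat2_scale_def vec_eq_iff algebra_simps)

text \<open>
  For \<open>g\<close> trivial modulo \<open>4\<close> the trace is even, so the division in \<open>theta\<close> is exact;
  \<open>mat c\<close> is the scalar matrix \<open>c \<cdot> Id\<close>.
\<close>

definition theta :: "mat2 \<Rightarrow> mat2" where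
  "theta g = g - mat (trace g div 2)"

definition Theta2 :: "mat2 \<times> mat2 \<Rightarrow> mat2 \<times> mat2" where
  "Theta2 = map_prod theta theta"

definition lie_span :: "(mat2 \<times> mat2) set \<Rightarrow> (mat2 \<times> mat2) set" where
  "lie_span G = module.span pair_scale (Theta2 ` G)"

lemma two_times_half_trace:
  assumes "mat2_cong 4 g (mat 1)"
  shows "2 * (trace g div 2) = trace g"
proof -
  have "4 dvd g $ i $ i - 1" for i
  proof -
    have "4 dvd g $ i $ i - mat 1 $ i $ i"
      using assms unfolding mat2_cong_def by blast
    then show ?thesis by (simp add: mat_def)
  qed
  from dvd_add[OF this[of 1] this[of 2]] have "4 dvd trace g - 2"
    by (simp add: trace_def sum_2 algebra_simps)
  then obtain c where "trace g - 2 = 4 * c" ..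
  then have "trace g = 2 * (2 * c + 1)"
    by (simp add: algebra_simps)
  moreover have "(2 :: zadic2) \<noteq> 0"
    using residue_pow2[of 1 2] by (auto simp: zero_zadic2.rep_eq)
  ultimately show ?thesis
    by (metis nonzero_mult_div_cancel_left)
qed

end

theory Submission
  imports Defs "HOL-Algebra.Coset"
begin

text \<open>
  Write \<open>B(s)\<close> for the principal congruence subgroup of level \<open>s\<close>, and say that \<open>x\<close> has
  exact level \<open>e\<close> if it lies in \<open>B(e)\<close> but not in \<open>B(e + 1)\<close>. By Goursat's principle
  everything is governed by the two kernels \<open>{x. (x, 1) \<in> G}\<close> and \<open>{y. (1, y) \<in> G}\<close>: if
  they contain \<open>B(a)\<close> and \<open>B(b)\<close>, then \<open>G\<close> contains \<open>B(a) \<times> B(b)\<close>. Each kernel is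
  normalised by a projection of \<open>G\<close>, hence by some \<open>B(n)\<close>. A subgroup that is open in
  \<open>SL\<^sub>2(\<int>\<^sub>2)\<close>, is normalised by \<open>B(n)\<close> and has an element of exact level \<open>e\<close>, with
  \<open>e, n \<ge> 3\<close>, contains \<open>B(e + 2 n + 2)\<close>, because double commutators with \<open>B(n)\<close> produce
  the adjoint ideal generated by that element, and a vector of \<open>\<ss>\<ll>\<^sub>2\<close> that is nonzero
  modulo 2 generates almost everything (\<open>normal_closure_contains\<close>). It therefore suffices
  to find in one kernel an element that is not too close to the identity.

  The Lie algebra enters through traces. If the two coordinates of every element of \<open>G\<close>
  had traces congruent modulo \<open>2\<^sup>r\<close>, then \<open>tr(u\<^sub>1 v\<^sub>1) - tr(u\<^sub>2 v\<^sub>2)\<close>, a bilinear form whose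
  values on \<open>\<Theta>\<^sub>2(G)\<close> are combinations of such trace differences, would vanish modulo \<open>2\<^sup>r\<close>
  on the whole span \<open>\<L>(G)\<close>. It takes the value \<open>2\<^bsup>2k\<^esup>\<close> at \<open>(2\<^sup>k E, 0)\<close>, \<open>(2\<^sup>k F, 0)\<close>, so some
  \<open>(g\<^sub>1, g\<^sub>2) \<in> G\<close> has \<open>tr g\<^sub>1\<close> and \<open>tr g\<^sub>2\<close> incongruent modulo \<open>2\<^bsup>2k+1\<^esup>\<close> (\<open>trace_gap\<close>). At
  least one of \<open>g\<^sub>1\<close>, \<open>g\<^sub>2\<close> is then outside \<open>B(k + 1)\<close>; by symmetry let it be \<open>g\<^sub>1\<close>.

  Such an element separates the coordinates. Modulo \<open>2\<^bsup>2s\<^esup>\<close> the elements \<open>1 + 2\<^sup>s Z\<close> multiply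
  like vectors \<open>Z\<close> modulo \<open>2\<^sup>s\<close>, so \<open>G \<inter> (B(s) \<times> B(s))\<close> is there a module over the adjoint
  action of \<open>(g\<^sub>1, g\<^sub>2)\<close>. Applying the characteristic polynomial of \<open>Ad g\<^sub>2\<close> kills the second
  coordinate, while on the first one it acts as \<open>(tr g\<^sub>1)\<^sup>2 - (tr g\<^sub>2)\<^sup>2\<close> times
  \<open>Ad g\<^sub>1 (Ad g\<^sub>1 - 1)\<close>, which is not too divisible by 2. The result is \<open>(w\<^sub>1, w\<^sub>2) \<in> G\<close> with
  \<open>w\<^sub>2 \<in> B(2s)\<close> and \<open>w\<^sub>1\<close> of exact level at most \<open>s\<close> plus a constant independent of \<open>s\<close>
  (\<open>deep_element\<close>). Normal closure turns this into: every \<open>x \<in> B(a)\<close>, with \<open>a - s\<close>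
  constant, is the first coordinate of an element of \<open>G\<close> whose second coordinate is in
  \<open>B(2s)\<close>.

  Finally take \<open>(y\<^sub>1, y\<^sub>2) \<in> G\<close> with \<open>y\<^sub>2 = 1 + 2\<^bsup>n\<^sub>2\<^esup> E\<close> and raise it to the power \<open>2\<^bsup>a-2\<^esup>\<close>. The
  first coordinate falls into \<open>B(a)\<close>, the second one has exact level \<open>n\<^sub>2 + a - 2\<close>, and for
  \<open>s\<close> large this is less than \<open>2s\<close>. Dividing by the element just found with the same first
  coordinate leaves \<open>(1, h) \<in> G\<close> with \<open>h\<close> of exact level \<open>n\<^sub>2 + a - 2\<close>. So the second
  kernel is large, and hence so is the first (\<open>kernels_contain\<close>).
\<close>

section \<open>Divisibility by powers of two in the 2-adic integers\<close>

instance zadic2 :: algebraic_semidom ..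

lemma prime_elem_two_zadic2: "prime_elem (2 :: zadic2)"
proof (rule prime_elemI)
  have even_iff: "2 dvd x \<longleftrightarrow> residue x 1 = 0" for x
    using pow2_dvd_zadic2_iff[of 1 x] by simp
  show "(2 :: zadic2) \<noteq> 0"
    using residue_pow2[of 1 2] by (auto simp: zero_zadic2.rep_eq)
  show "\<not> (2 :: zadic2) dvd 1"
    unfolding even_iff by (simp add: one_zadic2.rep_eq)
  fix x y :: zadic2
  assume "2 dvd x * y"
  then have "(residue x 1 * residue y 1) mod 2 = 0"
    unfolding even_iff by (simp add: times_zadic2.rep_eq)
  moreover have "residue x 1 \<in> {0, 1}" "residue y 1 \<in> {0, 1}"
    using residue_nonneg[of x 1] residue_less[of x 1] residue_nonneg[of y 1] residue_less[of y 1]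
    by auto
  ultimately show "2 dvd x \<or> 2 dvd y"
    unfolding even_iff by auto
qed

text \<open>The 2-adic valuation is additive; this form never mentions the valuation of zero.\<close>
lemma not_pow2_dvd_mult:
  fixes x y :: zadic2
  assumes "\<not> 2 ^ a dvd x" "\<not> 2 ^ b dvd y" "a + b = Suc c"
  shows "\<not> 2 ^ c dvd x * y"
  using prime_elem_power_dvd_cases[of 2 c x y a b] prime_elem_two_zadic2 assms by blast

lemma two_neq_zero_zadic2: "(2 :: zadic2) \<noteq> 0"
  using prime_elem_two_zadic2 by (simp add: prime_elem_def)

lemma pow2_mult_dvd_iff:
  fixes x :: zadic2
  shows "2 ^ (a + b) dvd 2 ^ a * x \<longleftrightarrow> 2 ^ b dvd x"
  using two_neq_zero_zadic2 by (simp add: power_add)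

lemma pow2_dvd_pow2_iff: "(2 :: zadic2) ^ m dvd 2 ^ n \<longleftrightarrow> m \<le> n"
proof -
  have "\<not> is_unit (2 :: zadic2)" using prime_elem_two_zadic2 by (simp add: prime_elem_def)
  then show ?thesis using two_neq_zero_zadic2 by (simp add: dvd_power_iff)
qed

lemma odd_even_zadic2: "\<not> 2 dvd (x :: zadic2) \<Longrightarrow> 2 dvd x - 1"
proof -
  assume "\<not> 2 dvd x"
  then have "residue x 1 = 1"
    using pow2_dvd_zadic2_iff[of 1 x] residue_nonneg[of x 1] residue_less[of x 1] by auto
  then show ?thesis
    using pow2_dvd_zadic2_iff[of 1 "x - 1"]
    by (simp add: minus_zadic2.rep_eq one_zadic2.rep_eq)
qed

lemma dvd_diff_swap: "(m :: zadic2) dvd a - b \<longleftrightarrow> m dvd b - a"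
  using dvd_minus_iff[of m "a - b"] by simp

text \<open>
  The natural numbers are dense in \<open>\<int>\<^sub>2\<close>. This lets powers with natural exponents imitate
  the multiplication of a Lie algebra element by an arbitrary 2-adic scalar.
\<close>
lemma ex_nat_pow2_dvd_add: "\<exists>c. 2 ^ n dvd (x :: zadic2) + of_nat c"
proof
  define m where "m = nat (residue (- x) n)"
  have "int m = residue (- x) n"
    using residue_nonneg[of "- x" n] by (simp add: m_def)
  then have "residue (x + of_nat m) n = 0"
    by (simp add: plus_zadic2.rep_eq residue_of_nat uminus_zadic2.rep_eq mod_simps)
  then show "2 ^ n dvd x + of_nat m"
    by (simp add: pow2_dvd_zadic2_iff)
qed

section \<open>Two-by-two matrices and their congruences\<close>

lemma mat2_eq_iff:
  "(A :: mat2) = B \<longleftrightarrow> A $ 1 $ 1 = B $ 1 $ 1 \<and> A $ 1 $ 2 = B $ 1 $ 2 \<and>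
    A $ 2 $ 1 = B $ 2 $ 1 \<and> A $ 2 $ 2 = B $ 2 $ 2"
  by (auto simp: vec_eq_iff forall_2)

lemma mat2_cong_iff:
  "mat2_cong m A B \<longleftrightarrow> m dvd A $ 1 $ 1 - B $ 1 $ 1 \<and> m dvd A $ 1 $ 2 - B $ 1 $ 2 \<and>
    m dvd A $ 2 $ 1 - B $ 2 $ 1 \<and> m dvd A $ 2 $ 2 - B $ 2 $ 2"
  by (auto simp: mat2_cong_def forall_2)

lemma mat2_mult_nth: "((A :: mat2) ** B) $ i $ j = A $ i $ 1 * B $ 1 $ j + A $ i $ 2 * B $ 2 $ j"
  by (simp add: matrix_matrix_mult_def sum_2)

lemma mat2_scale_nth [simp]: "mat2_scale c A $ i $ j = c * A $ i $ j"
  by (simp add: mat2_scale_def)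

lemma mat_nth: "(mat c :: mat2) $ i $ j = (if i = j then c else 0)"
  by (simp add: mat_def)

lemma trace_mat2: "trace (A :: mat2) = A $ 1 $ 1 + A $ 2 $ 2"
  by (simp add: trace_def sum_2)

lemmas mat2_entries = mat2_mult_nth mat_nth trace_mat2 det_2

lemma mat2_add_mult: "((A :: mat2) + B) ** (C :: mat2) = A ** C + B ** C"
  by (simp add: mat2_eq_iff mat2_mult_nth algebra_simps)

lemma mat2_scale_mult: "mat2_scale c A ** B = mat2_scale c (A ** B)"
  by (simp add: mat2_eq_iff mat2_mult_nth algebra_simps)

lemma mat2_diff_mult: "((A :: mat2) - B) ** (C :: mat2) = A ** C - B ** C"
  and mult_mat2_diff: "(C :: mat2) ** ((A :: mat2) - B) = C ** A - C ** B"
  by (simp_all add: mat2_eq_iff mat2_mult_nth algebra_simps)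

lemma mat2_mult_scale: "(A :: mat2) ** mat2_scale c B = mat2_scale c (A ** B)"
  by (simp add: mat2_eq_iff mat2_mult_nth algebra_simps)

lemma mat2_congI: "A = B + mat2_scale m C \<Longrightarrow> mat2_cong m A B"
  by (simp add: mat2_cong_def)

lemma mat2_congE:
  assumes "mat2_cong m A B"
  obtains C where "A = B + mat2_scale m C"
proof
  show "A = B + mat2_scale m (\<chi> i j. (A $ i $ j - B $ i $ j) div m)"
    using assms by (auto simp: mat2_cong_def vec_eq_iff)
qed

lemma mat2_cong_refl [simp]: "mat2_cong m A A"
  by (simp add: mat2_cong_def)

lemma mat2_cong_sym:
  assumes "mat2_cong m A B"
  shows "mat2_cong m B A"
proof -
  have "m dvd b - a" if "m dvd a - b" for a b :: zadic2
    using that by (subst dvd_diff_swap)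
  then show ?thesis using assms by (auto simp: mat2_cong_def)
qed

lemma mat2_cong_trans [trans]:
  assumes "mat2_cong m A B" "mat2_cong m B C"
  shows "mat2_cong m A C"
proof -
  have "m dvd a - c" if "m dvd a - b" "m dvd b - c" for a b c :: zadic2
    using dvd_add[OF that] by simp
  then show ?thesis using assms unfolding mat2_cong_def by blast
qed

lemma mat2_cong_mult:
  assumes "mat2_cong m A B" "mat2_cong m C D"
  shows "mat2_cong m (A ** C) (B ** D)"
proof -
  have "m dvd a * c - b * d" if "m dvd a - b" "m dvd c - d" for a b c d :: zadic2
  proof -
    have "a * c - b * d = (a - b) * c + b * (c - d)" by (simp add: algebra_simps)
    then show ?thesis using that by simp
  qed
  moreover have "(A ** C) $ i $ j - (B ** D) $ i $ j
      = (A $ i $ 1 * C $ 1 $ j - B $ i $ 1 * D $ 1 $ j)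
        + (A $ i $ 2 * C $ 2 $ j - B $ i $ 2 * D $ 2 $ j)" for i j
    by (simp add: mat2_mult_nth)
  ultimately show ?thesis
    using assms by (auto simp: mat2_cong_def intro!: dvd_add)
qed

lemma mat2_cong_add:
  assumes "mat2_cong m A B" "mat2_cong m C D"
  shows "mat2_cong m (A + C) (B + D)"
proof -
  have "m dvd a + c - (b + d)" if "m dvd a - b" "m dvd c - d" for a b c d :: zadic2
    using dvd_add[OF that] by (simp add: algebra_simps)
  then show ?thesis using assms by (simp add: mat2_cong_def)
qed

lemma mat2_cong_scale:
  assumes "mat2_cong m A B"
  shows "mat2_cong (c * m) (mat2_scale c A) (mat2_scale c B)"
proof -
  have "c * m dvd c * a - c * b" if "m dvd a - b" for a b
    using that by (metis mult_dvd_mono dvd_refl right_diff_distrib)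
  then show ?thesis using assms by (simp add: mat2_cong_def)
qed

lemma mat2_cong_dvd: "mat2_cong m A B \<Longrightarrow> d dvd m \<Longrightarrow> mat2_cong d A B"
  unfolding mat2_cong_def using dvd_trans by blast

lemma mat2_cong_le: "mat2_cong (2 ^ m) A B \<Longrightarrow> n \<le> m \<Longrightarrow> mat2_cong (2 ^ n) A B"
  using mat2_cong_dvd le_imp_power_dvd by blast

text \<open>The adjugate matrix, by Cayley-Hamilton: the inverse when the determinant is 1.\<close>
definition adj2 :: "mat2 \<Rightarrow> mat2" where
  "adj2 g = mat (trace g) - g"

lemma adj2_nth [simp]:
  "adj2 g $ 1 $ 1 = g $ 2 $ 2" "adj2 g $ 1 $ 2 = - g $ 1 $ 2"
  "adj2 g $ 2 $ 1 = - g $ 2 $ 1" "adj2 g $ 2 $ 2 = g $ 1 $ 1"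
  by (simp_all add: adj2_def mat2_entries)

lemma mem_SL2 [simp]: "g \<in> carrier SL2 \<longleftrightarrow> det g = 1"
  and mult_SL2 [simp]: "g \<otimes>\<^bsub>SL2\<^esub> h = g ** h"
  and one_SL2 [simp]: "\<one>\<^bsub>SL2\<^esub> = mat 1"
  by (simp_all add: SL2_def)

lemma adj2_mult_self: "adj2 g ** g = mat (det g)" and self_mult_adj2: "g ** adj2 g = mat (det g)"
  by (simp_all add: mat2_eq_iff mat2_entries algebra_simps)

lemma det_adj2 [simp]: "det (adj2 g) = det g"
  by (simp add: det_2 algebra_simps)

lemma det_one_inverse [simp]:
  assumes "det g = 1"
  shows "adj2 g ** g = mat 1" "g ** adj2 g = mat 1"
    "adj2 g ** (g ** A) = A" "g ** (adj2 g ** A) = A" "A ** g ** adj2 g = A" "A ** adj2 g ** g = A"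
  using assms by (simp_all add: adj2_mult_self self_mult_adj2 matrix_mul_assoc)
    (simp_all add: adj2_mult_self self_mult_adj2 matrix_mul_assoc[symmetric])

lemma inv_SL2 [simp]: "det g = 1 \<Longrightarrow> inv\<^bsub>SL2\<^esub> g = adj2 g"
  using group.inv_equality[OF group_SL2, of "adj2 g" g] by simp

lemma mat2_cong_adj2: "mat2_cong m A B \<Longrightarrow> mat2_cong m (adj2 A) (adj2 B)"
  by (simp add: mat2_cong_iff dvd_diff_swap[of m "B $ 1 $ 2"] dvd_diff_swap[of m "B $ 2 $ 1"])

lemma adj2_one [simp]: "adj2 (mat 1) = mat 1"
  by (simp add: mat2_eq_iff mat2_entries)

lemma mem_cong_subgroup: "g \<in> cong_subgroup s \<longleftrightarrow> det g = 1 \<and> mat2_cong (2 ^ s) g (mat 1)"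
  by (simp add: cong_subgroup_def)

lemma cong_subgroup_mono: "s \<le> t \<Longrightarrow> cong_subgroup t \<subseteq> cong_subgroup s"
  using mat2_cong_le by (auto simp: mem_cong_subgroup)

lemma mat2_cong_conj:
  assumes "det u = 1" "mat2_cong m g (mat 1)"
  shows "mat2_cong m (u ** g ** adj2 u) (mat 1)"
  using mat2_cong_mult[OF mat2_cong_mult[OF mat2_cong_refl assms(2)] mat2_cong_refl, of u "adj2 u"]
    assms(1) by simp

lemma cong_subgroup_normal: "cong_subgroup s \<lhd> SL2"
proof (rule group.normal_invI[OF group_SL2])
  show "subgroup (cong_subgroup s) SL2"
  proof (rule group.subgroupI[OF group_SL2])
    show "cong_subgroup s \<noteq> {}"
      using mem_cong_subgroup[of "mat 1" s] by auto
  next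
    fix a b assume "a \<in> cong_subgroup s" "b \<in> cong_subgroup s"
    then show "a \<otimes>\<^bsub>SL2\<^esub> b \<in> cong_subgroup s"
      using mat2_cong_mult[of "2 ^ s" a "mat 1" b "mat 1"] by (simp add: mem_cong_subgroup det_mul)
  next
    fix a assume "a \<in> cong_subgroup s"
    then show "inv\<^bsub>SL2\<^esub> a \<in> cong_subgroup s"
      using mat2_cong_adj2[of "2 ^ s" a "mat 1"] by (simp add: mem_cong_subgroup)
  qed (auto simp: mem_cong_subgroup)
next
  fix x h assume "x \<in> carrier SL2" "h \<in> cong_subgroup s"
  then show "x \<otimes>\<^bsub>SL2\<^esub> h \<otimes>\<^bsub>SL2\<^esub> inv\<^bsub>SL2\<^esub> x \<in> cong_subgroup s"
    using mat2_cong_conj by (simp add: mem_cong_subgroup det_mul)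
qed

section \<open>First-order approximation near the identity\<close>

text \<open>
  The matrix \<open>Z\<close> is the leading term of \<open>g\<close> at level \<open>m\<close>, known to a relative precision of
  \<open>j\<close> binary digits. As long as \<open>j \<le> m\<close>, second-order terms are invisible, and
  multiplication, inversion and commutators of group elements become addition, negation
  and brackets of their leading terms.
\<close>
definition near :: "nat \<Rightarrow> nat \<Rightarrow> mat2 \<Rightarrow> mat2 \<Rightarrow> bool" where
  "near m j g Z \<longleftrightarrow> mat2_cong (2 ^ (m + j)) g (mat 1 + mat2_scale (2 ^ m) Z)"

lemma near_iff:
  "near m j g Z \<longleftrightarrow> (\<exists>W. g = mat 1 + mat2_scale (2 ^ m) W \<and> mat2_cong (2 ^ j) W Z)"
proof
  assume "near m j g Z"
  then obtain C where C: "g = mat 1 + mat2_scale (2 ^ m) Z + mat2_scale (2 ^ (m + j)) C"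
    unfolding near_def by (rule mat2_congE)
  have "g = mat 1 + mat2_scale (2 ^ m) (Z + mat2_scale (2 ^ j) C)"
    unfolding C by (simp add: mat2_eq_iff power_add algebra_simps)
  then show "\<exists>W. g = mat 1 + mat2_scale (2 ^ m) W \<and> mat2_cong (2 ^ j) W Z"
    using mat2_congI by blast
next
  assume "\<exists>W. g = mat 1 + mat2_scale (2 ^ m) W \<and> mat2_cong (2 ^ j) W Z"
  then show "near m j g Z"
    unfolding near_def using mat2_cong_add[OF mat2_cong_refl mat2_cong_scale]
    by (auto simp: power_add)
qed

lemma near_cong: "near m j g Z \<Longrightarrow> mat2_cong (2 ^ j) Z W \<Longrightarrow> near m j g W"
  unfolding near_iff using mat2_cong_trans by blast

lemma near_unique:
  assumes "near m j g Z" "near m j g W"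
  shows "mat2_cong (2 ^ j) Z W"
proof -
  have "mat2_cong (2 ^ (m + j)) (mat 1 + mat2_scale (2 ^ m) Z) (mat 1 + mat2_scale (2 ^ m) W)"
    using mat2_cong_trans[OF mat2_cong_sym] assms unfolding near_def by blast
  then have "2 ^ (m + j) dvd 2 ^ m * (Z $ a $ b - W $ a $ b)" for a b
    by (simp add: mat2_cong_def right_diff_distrib)
  then show ?thesis
    unfolding mat2_cong_def pow2_mult_dvd_iff by blast
qed

lemma near_one: "near m j (mat 1) 0"
  by (simp add: near_def mat2_cong_def)

lemma near_self: "near m j (mat 1 + mat2_scale (2 ^ m) Z) Z"
  by (simp add: near_def)

lemma near_mult:
  assumes "near m j g Z" "near m j h W" "j \<le> m"
  shows "near m j (g ** h) (Z + W)"
proof -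
  have "mat2_cong (2 ^ (m + j)) (g ** h)
      ((mat 1 + mat2_scale (2 ^ m) Z) ** (mat 1 + mat2_scale (2 ^ m) W))"
    using assms(1,2) unfolding near_def by (rule mat2_cong_mult)
  also have "(mat 1 + mat2_scale (2 ^ m) Z) ** (mat 1 + mat2_scale (2 ^ m) W)
      = mat 1 + mat2_scale (2 ^ m) (Z + W) + mat2_scale (2 ^ (m + m)) (Z ** W)"
    by (simp add: mat2_eq_iff mat2_entries power_add algebra_simps)
  also have "mat2_cong (2 ^ (m + j)) \<dots> (mat 1 + mat2_scale (2 ^ m) (Z + W))"
    using mat2_cong_le[OF mat2_congI[OF refl], of "m + j" "m + m"] assms(3) by simp
  finally show ?thesis unfolding near_def .
qed

lemma near_conj:
  assumes "det u = 1" "near m j g Z"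
  shows "near m j (u ** g ** adj2 u) (u ** Z ** adj2 u)"
proof -
  have "mat2_cong (2 ^ (m + j)) (u ** g ** adj2 u)
      (u ** (mat 1 + mat2_scale (2 ^ m) Z) ** adj2 u)"
    using assms(2) unfolding near_def by (intro mat2_cong_mult mat2_cong_refl)
  also have "u ** (mat 1 + mat2_scale (2 ^ m) Z) ** adj2 u
      = u ** adj2 u + mat2_scale (2 ^ m) (u ** Z ** adj2 u)"
    by (simp add: mat2_eq_iff mat2_entries algebra_simps)
  finally show ?thesis unfolding near_def using assms(1) by simp
qed

lemma det_one_plus_scale: "det (mat 1 + mat2_scale c Z) = 1 + c * trace Z + c * c * det Z"
  by (simp add: mat2_entries algebra_simps)

text \<open>A leading term of an element of \<open>SL\<^sub>2\<close> lies in \<open>\<ss>\<ll>\<^sub>2\<close> up to the available precision.\<close>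
lemma near_trace:
  assumes "det g = 1" "near m j g Z" "j \<le> m"
  shows "2 ^ j dvd trace Z"
proof -
  obtain W where W: "g = mat 1 + mat2_scale (2 ^ m) W" "mat2_cong (2 ^ j) W Z"
    using assms(2) unfolding near_iff by blast
  have "2 ^ m * (trace W + 2 ^ m * det W) = 0"
    using assms(1) unfolding W(1) det_one_plus_scale by (simp add: algebra_simps)
  then have "trace W = - (2 ^ m * det W)"
    using two_neq_zero_zadic2 by (simp add: add_eq_0_iff2)
  moreover have "(2 :: zadic2) ^ j dvd 2 ^ m"
    using assms(3) by (rule le_imp_power_dvd)
  ultimately have "2 ^ j dvd trace W"
    by simp
  moreover have "2 ^ j dvd trace W - trace Z"
  proof -
    have "2 ^ j dvd (W $ 1 $ 1 - Z $ 1 $ 1) + (W $ 2 $ 2 - Z $ 2 $ 2)"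
      using W(2) by (auto simp: mat2_cong_iff)
    then show ?thesis by (simp add: trace_mat2 algebra_simps)
  qed
  ultimately show ?thesis
    using dvd_diff[of "2 ^ j" "trace W" "trace W - trace Z"] by simp
qed

lemma near_adj2:
  assumes "det g = 1" "near m j g Z" "j \<le> m"
  shows "near m j (adj2 g) (- Z)"
proof -
  have "mat2_cong (2 ^ (m + j)) (adj2 g) (adj2 (mat 1 + mat2_scale (2 ^ m) Z))"
    using assms(2) unfolding near_def by (rule mat2_cong_adj2)
  also have "adj2 (mat 1 + mat2_scale (2 ^ m) Z) = mat 1 + mat2_scale (2 ^ m) (adj2 Z)"
    by (simp add: mat2_eq_iff mat2_entries)
  finally have "near m j (adj2 g) (adj2 Z)"
    unfolding near_def .
  moreover have "mat2_cong (2 ^ j) (adj2 Z) (- Z)"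
    using near_trace[OF assms] by (simp add: mat2_cong_iff trace_mat2 add.commute)
  ultimately show ?thesis
    by (rule near_cong)
qed

text \<open>
  From \<open>x u = u x + 2\<^bsup>e+n\<^esup> [X, U]\<close> one gets \<open>x u x\<^sup>-\<^sup>1 u\<^sup>-\<^sup>1 = 1 + 2\<^bsup>e+n\<^esup> [X, U] x\<^sup>-\<^sup>1 u\<^sup>-\<^sup>1\<close>, and the
  last two factors are trivial modulo \<open>2\<^sup>j\<close>. No digit of relative precision is lost, so the
  lemma can be iterated.
\<close>
lemma near_commutator:
  assumes "det x = 1" "det u = 1" "near e j x X" "near n j u U" "j \<le> e" "j \<le> n"
  shows "near (e + n) j (x ** (u ** adj2 x ** adj2 u)) (X ** U - U ** X)"
proof -
  obtain X' where X': "x = mat 1 + mat2_scale (2 ^ e) X'" "mat2_cong (2 ^ j) X' X"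
    using assms(3) unfolding near_iff by blast
  obtain U' where U': "u = mat 1 + mat2_scale (2 ^ n) U'" "mat2_cong (2 ^ j) U' U"
    using assms(4) unfolding near_iff by blast
  define v where "v = adj2 x ** adj2 u"
  have "x ** u = u ** x + mat2_scale (2 ^ (e + n)) (X' ** U' - U' ** X')"
    unfolding X'(1) U'(1) by (simp add: mat2_eq_iff mat2_entries power_add algebra_simps)
  moreover have "u ** x ** v = mat 1"
    using assms(1,2) by (simp add: v_def matrix_mul_assoc)
  ultimately have "x ** u ** v = mat 1 + mat2_scale (2 ^ (e + n)) ((X' ** U' - U' ** X') ** v)"
    by (simp add: mat2_add_mult mat2_scale_mult)
  then have comm: "x ** (u ** adj2 x ** adj2 u)
      = mat 1 + mat2_scale (2 ^ (e + n)) ((X' ** U' - U' ** X') ** v)"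
    by (simp add: v_def matrix_mul_assoc)
  have "mat2_cong (2 ^ j) x (mat 1)" "mat2_cong (2 ^ j) u (mat 1)"
    using mat2_cong_le[OF mat2_congI[OF X'(1)] assms(5)]
      mat2_cong_le[OF mat2_congI[OF U'(1)] assms(6)] .
  then have "mat2_cong (2 ^ j) v (adj2 (mat 1) ** adj2 (mat 1))"
    unfolding v_def by (intro mat2_cong_mult mat2_cong_adj2)
  then have v: "mat2_cong (2 ^ j) v (mat 1)"
    by simp
  have neg: "mat2_cong (2 ^ j) (- (U' ** X')) (- (U ** X))"
    using mat2_cong_mult[OF U'(2) X'(2)]
    by (auto simp: mat2_cong_def dvd_diff_swap[of _ "(U ** X) $ i $ j" for i j])
  have "mat2_cong (2 ^ j) ((X' ** U' - U' ** X') ** v) ((X ** U - U ** X) ** mat 1)"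
    using mat2_cong_mult[OF mat2_cong_add[OF mat2_cong_mult[OF X'(2) U'(2)] neg] v] by simp
  then show ?thesis
    unfolding comm near_iff by auto
qed

lemma near_imp_mem:
  assumes "det g = 1" "near m j g Z"
  shows "g \<in> cong_subgroup m"
  using assms mat2_congI unfolding near_iff mem_cong_subgroup by blast

lemma cong_subgroup_nearE:
  assumes "g \<in> cong_subgroup m"
  obtains Z where "g = mat 1 + mat2_scale (2 ^ m) Z"
  using assms mat2_congE unfolding mem_cong_subgroup by blast

section \<open>Normal closures\<close>

text \<open>
  The leading terms at level \<open>m\<close> of elements of \<open>Q\<close>. For a subgroup \<open>Q\<close> and \<open>j \<le> m\<close> they
  form a \<open>\<int>\<^sub>2\<close>-module, closed under congruence modulo \<open>2\<^sup>j\<close>.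
\<close>
definition layer :: "mat2 set \<Rightarrow> nat \<Rightarrow> nat \<Rightarrow> mat2 set" where
  "layer Q m j = {Z. \<exists>q\<in>Q. near m j q Z}"

context
  fixes Q :: "mat2 set"
  assumes Q: "subgroup Q SL2"
begin

lemma subgroup_SL2_mult: "g \<in> Q \<Longrightarrow> h \<in> Q \<Longrightarrow> g ** h \<in> Q"
  using subgroup.m_closed[OF Q] by simp

lemma subgroup_SL2_det: "g \<in> Q \<Longrightarrow> det g = 1"
  using subgroup.mem_carrier[OF Q] by simp

lemma subgroup_SL2_adj2: "g \<in> Q \<Longrightarrow> adj2 g \<in> Q"
  using subgroup.m_inv_closed[OF Q] subgroup_SL2_det by fastforce

lemma layer_zero: "0 \<in> layer Q m j"
  using near_one subgroup.one_closed[OF Q] unfolding layer_def by auto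

lemma layer_add: "j \<le> m \<Longrightarrow> Z \<in> layer Q m j \<Longrightarrow> W \<in> layer Q m j \<Longrightarrow> Z + W \<in> layer Q m j"
  unfolding layer_def using near_mult subgroup_SL2_mult by blast

lemma layer_cong: "Z \<in> layer Q m j \<Longrightarrow> mat2_cong (2 ^ j) Z W \<Longrightarrow> W \<in> layer Q m j"
  unfolding layer_def using near_cong by blast

lemma layer_scale:
  assumes "j \<le> m" "Z \<in> layer Q m j"
  shows "mat2_scale c Z \<in> layer Q m j"
proof -
  have *: "mat2_scale (of_nat k) Z \<in> layer Q m j" for k
  proof (induction k)
    case 0
    have "mat2_scale 0 Z = 0" by (simp add: vec_eq_iff)
    then show ?case using layer_zero by simp
  next
    case (Suc k)
    have "mat2_scale (of_nat (Suc k)) Z = Z + mat2_scale (of_nat k) Z"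
      by (simp add: vec_eq_iff algebra_simps)
    then show ?case using layer_add Suc assms by simp
  qed
  obtain k where k: "2 ^ j dvd - c + of_nat k"
    using ex_nat_pow2_dvd_add by blast
  have "mat2_cong (2 ^ j) (mat2_scale (of_nat k) Z) (mat2_scale c Z)"
    using k by (simp add: mat2_cong_def flip: left_diff_distrib)
  then show ?thesis using * layer_cong by blast
qed

end

definition sl2_e :: mat2 where "sl2_e = vector [vector [0, 1], vector [0, 0]]"
definition sl2_f :: mat2 where "sl2_f = vector [vector [0, 0], vector [1, 0]]"
definition sl2_h :: mat2 where "sl2_h = vector [vector [1, 0], vector [0, - 1]]"

lemma sl2_basis_nth [simp]:
  "sl2_e $ 1 $ 1 = 0" "sl2_e $ 1 $ 2 = 1" "sl2_e $ 2 $ 1 = 0" "sl2_e $ 2 $ 2 = 0"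
  "sl2_f $ 1 $ 1 = 0" "sl2_f $ 1 $ 2 = 0" "sl2_f $ 2 $ 1 = 1" "sl2_f $ 2 $ 2 = 0"
  "sl2_h $ 1 $ 1 = 1" "sl2_h $ 1 $ 2 = 0" "sl2_h $ 2 $ 1 = 0" "sl2_h $ 2 $ 2 = - 1"
  by (simp_all add: sl2_e_def sl2_f_def sl2_h_def vector_2)

definition bracket :: "mat2 \<Rightarrow> mat2 \<Rightarrow> mat2" where
  "bracket A B = A ** B - B ** A"

text \<open>
  These matrices of square zero form a basis of \<open>\<ss>\<ll>\<^sub>2\<close>. Unlike for \<open>sl2_h\<close>, the elements
  \<open>1 + c U\<close> lie in \<open>SL\<^sub>2\<close> without any correction term, and squaring them doubles \<open>c\<close>.
\<close>
definition nilpotents :: "mat2 set" where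
  "nilpotents = {sl2_e, sl2_f, sl2_h - sl2_e + sl2_f}"

lemma det_one_plus_nilpotent:
  assumes "U \<in> nilpotents"
  shows "det (mat 1 + mat2_scale c U) = 1"
proof -
  consider "U = sl2_e" | "U = sl2_f" | "U = sl2_h - sl2_e + sl2_f"
    using assms unfolding nilpotents_def by blast
  then show ?thesis
    by cases (simp_all only:, simp_all add: mat2_entries algebra_simps)
qed

lemma nilpotent_square:
  assumes "U \<in> nilpotents"
  shows "U ** U = 0"
proof -
  consider "U = sl2_e" | "U = sl2_f" | "U = sl2_h - sl2_e + sl2_f"
    using assms unfolding nilpotents_def by blast
  then show ?thesis
    by cases (simp_all only:, simp_all add: mat2_eq_iff mat2_entries)
qed

text \<open>
  By linearity, brackets with \<open>H\<close> are available too. For \<open>X = [[p, b], [c, -p]]\<close> the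
  double brackets with \<open>E\<close>, \<open>F\<close>, \<open>H\<close> include \<open>2c E\<close>, \<open>2c H\<close>, \<open>2b F\<close>, \<open>2b H\<close>, \<open>4p E\<close>,
  \<open>4p F\<close>, \<open>2p H + 2c F\<close> and \<open>2p H + 2b E\<close>, up to sign. Whichever of \<open>p\<close>, \<open>b\<close>, \<open>c\<close> is odd,
  their span contains \<open>4 \<ss>\<ll>\<^sub>2\<close>. Since the trace of \<open>X\<close> is only known to vanish modulo 8,
  everything is done modulo 8.
\<close>
lemma double_brackets_generate:
  fixes S :: "mat2 set"
  assumes add: "\<And>Z W. Z \<in> S \<Longrightarrow> W \<in> S \<Longrightarrow> Z + W \<in> S"
    and scale: "\<And>c Z. Z \<in> S \<Longrightarrow> mat2_scale c Z \<in> S"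
    and cong: "\<And>Z W. Z \<in> S \<Longrightarrow> mat2_cong (2 ^ 3) Z W \<Longrightarrow> W \<in> S"
    and brackets: "\<And>U V. U \<in> nilpotents \<Longrightarrow> V \<in> nilpotents \<Longrightarrow> bracket (bracket X U) V \<in> S"
    and trace: "2 ^ 3 dvd trace X"
    and odd: "\<not> mat2_cong 2 X 0"
  shows "mat2_scale 4 sl2_e \<in> S" "mat2_scale 4 sl2_f \<in> S" "mat2_scale 4 sl2_h \<in> S"
proof -
  let ?N = "sl2_h - sl2_e + sl2_f"
  have nil: "sl2_e \<in> nilpotents" "sl2_f \<in> nilpotents" "?N \<in> nilpotents"
    by (auto simp: nilpotents_def)
  have comb: "mat2_scale a Z + mat2_scale b W \<in> S" if "Z \<in> S" "W \<in> S" for a b Z W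
    using that add scale by blast
  have h_right: "bracket (bracket X U) sl2_h \<in> S" if "U \<in> nilpotents" for U
  proof -
    have "bracket (bracket X U) sl2_h = mat2_scale 1 (bracket (bracket X U) ?N)
        + mat2_scale 1 (mat2_scale 1 (bracket (bracket X U) sl2_e)
          + mat2_scale (- 1) (bracket (bracket X U) sl2_f))"
      by (simp add: mat2_eq_iff bracket_def mat2_mult_nth algebra_simps)
    then show ?thesis using comb brackets that nil by metis
  qed
  have h_left: "bracket (bracket X sl2_h) V \<in> S" if "V \<in> nilpotents" for V
  proof -
    have "bracket (bracket X sl2_h) V = mat2_scale 1 (bracket (bracket X ?N) V)
        + mat2_scale 1 (mat2_scale 1 (bracket (bracket X sl2_e) V)
          + mat2_scale (- 1) (bracket (bracket X sl2_f) V))"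
      by (simp add: mat2_eq_iff bracket_def mat2_mult_nth algebra_simps)
    then show ?thesis using comb brackets that nil by metis
  qed
  define p b c where "p = X $ 1 $ 1" and "b = X $ 1 $ 2" and "c = X $ 2 $ 1"
  obtain r where r: "trace X = 8 * r"
    using trace by (auto elim: dvdE)
  have d: "X $ 2 $ 2 = 8 * r - p"
    using r by (simp add: trace_mat2 p_def algebra_simps)
  note X = p_def[symmetric] b_def[symmetric] c_def[symmetric] d
  note br = bracket_def mat2_mult_nth X
  have ee: "mat2_scale (2 * c) sl2_e \<in> S"
    and ff: "mat2_scale (2 * b) sl2_f \<in> S"
    and he: "mat2_scale (2 * c) sl2_h \<in> S"
    and hf: "mat2_scale (2 * b) sl2_h \<in> S"
  proof -
    have "mat2_scale (2 * c) sl2_e = mat2_scale (- 1) (bracket (bracket X sl2_e) sl2_e)"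
      "mat2_scale (2 * b) sl2_f = mat2_scale (- 1) (bracket (bracket X sl2_f) sl2_f)"
      "mat2_scale (2 * c) sl2_h = mat2_scale (- 1) (bracket (bracket X sl2_h) sl2_e)"
      "mat2_scale (2 * b) sl2_h = mat2_scale (- 1) (bracket (bracket X sl2_h) sl2_f)"
      by (simp_all add: mat2_eq_iff br algebra_simps)
    then show "mat2_scale (2 * c) sl2_e \<in> S" "mat2_scale (2 * b) sl2_f \<in> S"
      "mat2_scale (2 * c) sl2_h \<in> S" "mat2_scale (2 * b) sl2_h \<in> S"
      using scale brackets h_left nil by simp_all
  qed
  have [simp]: "8 dvd r * 16"
    by (rule dvdI[of _ _ "2 * r"]) simp
  have eh: "mat2_scale (4 * p) sl2_e \<in> S" and fh: "mat2_scale (4 * p) sl2_f \<in> S"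
  proof -
    have "mat2_cong (2 ^ 3) (mat2_scale (- 1) (bracket (bracket X sl2_e) sl2_h))
        (mat2_scale (4 * p) sl2_e)"
      "mat2_cong (2 ^ 3) (mat2_scale (- 1) (bracket (bracket X sl2_f) sl2_h))
        (mat2_scale (4 * p) sl2_f)"
      by (simp_all add: mat2_cong_iff br algebra_simps)
    then show "mat2_scale (4 * p) sl2_e \<in> S" "mat2_scale (4 * p) sl2_f \<in> S"
      using scale cong h_right nil by blast+
  qed
  have ef: "mat2_scale (4 * p) sl2_h + mat2_scale (4 * c) sl2_f \<in> S"
    and fe: "mat2_scale (4 * p) sl2_h + mat2_scale (4 * b) sl2_e \<in> S"
  proof -
    have "mat2_cong (2 ^ 3) (mat2_scale 2 (bracket (bracket X sl2_e) sl2_f))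
        (mat2_scale (4 * p) sl2_h + mat2_scale (4 * c) sl2_f)"
      "mat2_cong (2 ^ 3) (mat2_scale 2 (bracket (bracket X sl2_f) sl2_e))
        (mat2_scale (4 * p) sl2_h + mat2_scale (4 * b) sl2_e)"
      by (simp_all add: mat2_cong_iff br algebra_simps)
    then show "mat2_scale (4 * p) sl2_h + mat2_scale (4 * c) sl2_f \<in> S"
      "mat2_scale (4 * p) sl2_h + mat2_scale (4 * b) sl2_e \<in> S"
      using scale cong brackets nil by blast+
  qed
  \<comment> \<open>modulo 8 an odd multiple of 4 is 4, so odd coefficients can be divided out\<close>
  have odd_scale: "mat2_scale 4 Z \<in> S" if x: "\<not> 2 dvd x" and Z: "mat2_scale (4 * x) Z \<in> S" for x Z
  proof (rule cong[OF Z])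
    obtain y where "x = 1 + 2 * y"
      using odd_even_zadic2[OF x] by (metis add_diff_cancel_left' diff_add_cancel add.commute dvdE)
    then show "mat2_cong (2 ^ 3) (mat2_scale (4 * x) Z) (mat2_scale 4 Z)"
      by (auto intro!: mat2_congI[where C = "mat2_scale y Z"] simp: mat2_eq_iff algebra_simps)
  qed
  have double: "mat2_scale (4 * x) Z \<in> S" if "mat2_scale (2 * x) Z \<in> S" for x Z
  proof -
    have "mat2_scale (4 * x) Z = mat2_scale 2 (mat2_scale (2 * x) Z)"
      by (simp add: vec_eq_iff)
    then show ?thesis using scale that by simp
  qed
  have cancel_h: "Z \<in> S" if "W + Z \<in> S" "mat2_scale 4 W' \<in> S" "W = mat2_scale (4 * y) W'" for W Z W' y
  proof -
    have "Z = mat2_scale 1 (W + Z) + mat2_scale (- y) (mat2_scale 4 W')"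
      using that(3) by (simp add: vec_eq_iff)
    then show ?thesis using comb that(1,2) by metis
  qed
  have "mat2_scale 4 sl2_e \<in> S \<and> mat2_scale 4 sl2_f \<in> S \<and> mat2_scale 4 sl2_h \<in> S"
  proof (cases "2 dvd c")
    case False
    have h: "mat2_scale 4 sl2_h \<in> S" and e: "mat2_scale 4 sl2_e \<in> S"
      using odd_scale[OF False] double he ee by blast+
    have "mat2_scale (4 * c) sl2_f \<in> S"
      using cancel_h[OF ef h refl] .
    then show ?thesis using odd_scale[OF False] h e by blast
  next
    case c: True
    show ?thesis
    proof (cases "2 dvd b")
      case False
      have h: "mat2_scale 4 sl2_h \<in> S" and f: "mat2_scale 4 sl2_f \<in> S"
        using odd_scale[OF False] double hf ff by blast+
      have "mat2_scale (4 * b) sl2_e \<in> S"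
        using cancel_h[OF fe h refl] .
      then show ?thesis using odd_scale[OF False] h f by blast
    next
      case b: True
      have p: "\<not> 2 dvd p"
      proof
        assume "2 dvd p"
        moreover have "2 dvd 8 * r"
          by (rule dvdI[of _ _ "4 * r"]) simp
        ultimately have "2 dvd 8 * r - p"
          by (rule dvd_diff[rotated])
        with \<open>2 dvd p\<close> b c odd show False
          by (simp add: mat2_cong_iff X)
      qed
      obtain c' where "c = 2 * c'"
        using c ..
      then have "mat2_cong (2 ^ 3) (mat2_scale (4 * p) sl2_h + mat2_scale (4 * c) sl2_f)
          (mat2_scale (4 * p) sl2_h)"
        by (simp add: mat2_cong_iff)
      then have "mat2_scale (4 * p) sl2_h \<in> S"
        using cong ef by blast
      then show ?thesis using odd_scale[OF p] eh fh by blast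
    qed
  qed
  then show "mat2_scale 4 sl2_e \<in> S" "mat2_scale 4 sl2_f \<in> S" "mat2_scale 4 sl2_h \<in> S"
    by auto
qed

text \<open>
  Successive approximation: if the leading terms of \<open>Q\<close> at level \<open>m\<close> exhaust \<open>\<ss>\<ll>\<^sub>2\<close> modulo
  2, every element of \<open>B(m)\<close> can be moved into \<open>B(m + 1)\<close> by an element of \<open>Q\<close>. The
  process may stop at level \<open>N\<close>, so no limit is needed.
\<close>
lemma cong_subgroup_subset_if_layers:
  assumes Q: "subgroup Q SL2" and "cong_subgroup N \<subseteq> Q" and "a \<ge> 1"
    and basis: "\<And>m. m \<ge> a \<Longrightarrow> {sl2_e, sl2_f, sl2_h} \<subseteq> layer Q m 1"
  shows "cong_subgroup a \<subseteq> Q"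
proof -
  have descend: "cong_subgroup m \<subseteq> Q" if "cong_subgroup (Suc m) \<subseteq> Q" "m \<ge> a" for m
  proof
    fix g assume g: "g \<in> cong_subgroup m"
    then obtain W where W: "g = mat 1 + mat2_scale (2 ^ m) W"
      by (rule cong_subgroup_nearE)
    have det: "det g = 1" using g by (simp add: mem_cong_subgroup)
    have m: "1 \<le> m" using that(2) assms(3) by simp
    have near: "near m 1 g W" unfolding W by (rule near_self)
    then have tr: "2 dvd trace W"
      using near_trace[OF det _ m] by simp
    let ?W = "mat2_scale (W $ 1 $ 2) sl2_e + mat2_scale (W $ 2 $ 1) sl2_f
        + mat2_scale (W $ 1 $ 1) sl2_h"
    have "2 dvd - W $ 1 $ 1 - W $ 2 $ 2"
      using tr dvd_minus_iff[of 2 "trace W"] by (simp add: trace_mat2)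
    then have cong: "mat2_cong (2 ^ 1) ?W W"
      by (simp add: mat2_cong_iff)
    have "?W \<in> layer Q m 1"
      using basis[OF that(2)] layer_add[OF Q m] layer_scale[OF Q m] by simp
    then obtain q where q: "q \<in> Q" "near m 1 q W"
      using layer_cong[OF Q _ cong] unfolding layer_def by blast
    have dq: "det q = 1" using subgroup_SL2_det[OF Q q(1)] .
    have "near m 1 (adj2 q ** g) (- W + W)"
      using near_mult[OF near_adj2[OF dq q(2) m] near m] .
    then have "adj2 q ** g \<in> cong_subgroup (Suc m)"
      using det dq by (simp add: near_def mem_cong_subgroup det_mul mat2_cong_def)
    then have "adj2 q ** g \<in> Q" using that(1) by blast
    then have "q ** (adj2 q ** g) \<in> Q" using subgroup_SL2_mult[OF Q q(1)] by blast
    then show "g \<in> Q" using dq by simp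
  qed
  show ?thesis
  proof (cases "a \<le> N")
    case True
    then show ?thesis
    proof (induction rule: inc_induct)
      case base
      show ?case using assms(2) .
    next
      case (step n)
      then show ?case using descend by simp
    qed
  next
    case False
    then show ?thesis using assms(2) cong_subgroup_mono[of N a] by force
  qed
qed

text \<open>
  With \<open>x = 1 + 2\<^sup>e X\<close> and \<open>X\<close> nonzero modulo 2, the double commutators of \<open>x\<close> with
  \<open>1 + 2\<^sup>n U\<close> and \<open>1 + 2\<^bsup>n+i\<^esup> V\<close> have leading terms \<open>[[X, U], V]\<close> at level \<open>e + 2 n + i\<close>;
  modulo 8 their span contains \<open>4 \<ss>\<ll>\<^sub>2\<close>, and the factor 4 costs the two additional levels.
  Varying \<open>i\<close> fills all deeper layers. Three digits of precision are needed to see a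
  multiple of 4 modulo 8, whence the bounds \<open>n \<ge> 3\<close> and \<open>e \<ge> 3\<close>.
\<close>
lemma normal_closure_contains:
  assumes Q: "subgroup Q SL2" and "cong_subgroup N \<subseteq> Q" and n: "n \<ge> 3"
    and normalized: "\<And>u q. u \<in> cong_subgroup n \<Longrightarrow> q \<in> Q \<Longrightarrow> u ** q ** adj2 u \<in> Q"
    and x: "x \<in> Q" "x \<in> cong_subgroup e" "x \<notin> cong_subgroup (Suc e)" and e: "e \<ge> 3"
  shows "cong_subgroup (e + 2 * n + 2) \<subseteq> Q"
proof (rule cong_subgroup_subset_if_layers[OF Q assms(2)])
  obtain X where X: "x = mat 1 + mat2_scale (2 ^ e) X"
    using x(2) by (rule cong_subgroup_nearE)
  have det_x: "det x = 1" using subgroup_SL2_det[OF Q x(1)] .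
  have near_x: "near e 3 x X" unfolding X by (rule near_self)
  have odd: "\<not> mat2_cong 2 X 0"
  proof
    assume "mat2_cong 2 X 0"
    then obtain C where "X = 0 + mat2_scale 2 C" by (rule mat2_congE)
    then have "x = mat 1 + mat2_scale (2 ^ Suc e) C"
      unfolding X by (simp add: vec_eq_iff)
    then show False
      using x(3) det_x mat2_congI by (auto simp: mem_cong_subgroup)
  qed
  fix m assume m: "m \<ge> e + 2 * n + 2"
  define i where "i = m - 2 - e - 2 * n"
  define M where "M = e + n + (n + i)"
  have M: "m = M + 2" "3 \<le> M" using m n by (auto simp: M_def i_def)
  have brackets: "bracket (bracket X U) V \<in> layer Q M 3"
    if "U \<in> nilpotents" "V \<in> nilpotents" for U V
  proof -
    define u where "u = mat 1 + mat2_scale (2 ^ n) U"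
    define v where "v = mat 1 + mat2_scale (2 ^ (n + i)) V"
    have det: "det u = 1" "det v = 1"
      unfolding u_def v_def using det_one_plus_nilpotent that by auto
    have near: "near n 3 u U" "near (n + i) 3 v V"
      unfolding u_def v_def by (rule near_self)+
    have mem: "u \<in> cong_subgroup n" "v \<in> cong_subgroup n"
      using near_imp_mem[OF det(1) near(1)] near_imp_mem[OF det(2) near(2)]
        cong_subgroup_mono[of n "n + i"] by auto
    have comm: "g ** (w ** adj2 g ** adj2 w) \<in> Q" if "g \<in> Q" "w \<in> cong_subgroup n" for g w
      using that subgroup_SL2_mult[OF Q] subgroup_SL2_adj2[OF Q] normalized by blast
    define y where "y = x ** (u ** adj2 x ** adj2 u)"
    have y: "y \<in> Q" unfolding y_def using comm x(1) mem(1) .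
    have near_y: "near (e + n) 3 y (bracket X U)"
      unfolding y_def bracket_def using near_commutator det_x det near_x near e n by blast
    have "near M 3 (y ** (v ** adj2 y ** adj2 v)) (bracket (bracket X U) V)"
      unfolding M_def bracket_def[of _ V]
      using near_commutator[OF subgroup_SL2_det[OF Q y] det(2) near_y near(2)] e n by simp
    then show ?thesis
      unfolding layer_def using comm[OF y mem(2)] by blast
  qed
  have four: "mat2_scale 4 sl2_e \<in> layer Q M 3" "mat2_scale 4 sl2_f \<in> layer Q M 3"
    "mat2_scale 4 sl2_h \<in> layer Q M 3"
    using double_brackets_generate[OF layer_add[OF Q M(2)] layer_scale[OF Q M(2)]
        layer_cong[OF Q] brackets near_trace[OF det_x near_x e] odd] by auto
  have "Z \<in> layer Q m 1" if "mat2_scale 4 Z \<in> layer Q M 3" for Z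
  proof -
    have "mat2_scale (2 ^ M) (mat2_scale 4 Z) = mat2_scale (2 ^ m) Z"
      by (simp add: vec_eq_iff M(1) power_add)
    moreover have "m + 1 = M + 3" using M(1) by simp
    ultimately show ?thesis using that by (simp only: layer_def near_def mem_Collect_eq)
  qed
  then show "{sl2_e, sl2_f, sl2_h} \<subseteq> layer Q m 1"
    using four by blast
qed (use n in simp)

section \<open>Open subgroups\<close>

text \<open>
  The topology on matrices is the one of a product of copies of \<open>\<int>\<^sub>2\<close>, so neighbourhoods
  have to be shrunk once for the entries of a row and once for the rows. The sum
  \<open>n 1 + n 2\<close> serves as a common upper bound of two precisions.
\<close>
lemma open_vec2_contains:
  fixes T :: "(zadic2 ^ 2) set"
  assumes "open T" "v \<in> T"
  shows "\<exists>n. \<forall>w. (\<forall>j. 2 ^ n dvd w $ j - v $ j) \<longrightarrow> w \<in> T"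
proof -
  obtain S where S: "\<And>i. open (S i)" "\<And>i. v $ i \<in> S i" "\<And>w. (\<And>i. w $ i \<in> S i) \<Longrightarrow> w \<in> T"
    using assms unfolding open_vec_def by metis
  have "\<exists>n. \<forall>z. 2 ^ n dvd z - v $ i \<longrightarrow> z \<in> S i" for i
    using S(1,2)[of i] unfolding open_zadic2_def by blast
  then obtain n where n: "\<And>i z. 2 ^ n i dvd z - v $ i \<Longrightarrow> z \<in> S i"
    by metis
  have "n i \<le> n 1 + n 2" for i :: 2
    using exhaust_2[of i] by auto
  then have "w \<in> T" if "\<And>j. 2 ^ (n 1 + n 2) dvd w $ j - v $ j" for w
    using S(3) n that dvd_trans[OF le_imp_power_dvd] by blast
  then show ?thesis by blast
qed

lemma open_mat2_contains:
  fixes T :: "mat2 set"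
  assumes "open T" "A \<in> T"
  shows "\<exists>n. \<forall>B. mat2_cong (2 ^ n) B A \<longrightarrow> B \<in> T"
proof -
  obtain S where S: "\<And>i. open (S i)" "\<And>i. A $ i \<in> S i" "\<And>B. (\<And>i. B $ i \<in> S i) \<Longrightarrow> B \<in> T"
    using assms unfolding open_vec_def[where 'b = 2] by metis
  obtain n where n: "\<And>i w. (\<And>j. 2 ^ n i dvd w $ j - A $ i $ j) \<Longrightarrow> w \<in> S i"
    using open_vec2_contains[OF S(1,2)] by metis
  have "n i \<le> n 1 + n 2" for i :: 2
    using exhaust_2[of i] by auto
  then have le: "mat2_cong (2 ^ n i) B A" if "mat2_cong (2 ^ (n 1 + n 2)) B A" for B i
    using that mat2_cong_le by blast
  have "B \<in> T" if "mat2_cong (2 ^ (n 1 + n 2)) B A" for B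
    using S(3) n le[OF that] unfolding mat2_cong_def by blast
  then show ?thesis by blast
qed

lemma open_subgroup_contains_level:
  assumes "subgroup G (SL2 \<times>\<times> SL2)" "openin (top_of_set (carrier (SL2 \<times>\<times> SL2))) G"
  shows "\<exists>N. cong_subgroup2 N N \<subseteq> G"
proof -
  obtain T where T: "open T" "G = carrier (SL2 \<times>\<times> SL2) \<inter> T"
    using assms(2) unfolding openin_open by blast
  have "(mat 1, mat 1) \<in> T"
    using subgroup.one_closed[OF assms(1)] T(2) by simp
  then obtain A B where AB: "open A" "open B" "mat 1 \<in> A" "mat 1 \<in> B" "A \<times> B \<subseteq> T"
    using open_prod_elim[OF T(1)] by (metis mem_Sigma_iff)
  obtain a where a: "\<And>M. mat2_cong (2 ^ a) M (mat 1) \<Longrightarrow> M \<in> A"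
    using open_mat2_contains[OF AB(1,3)] by blast
  obtain b where b: "\<And>M. mat2_cong (2 ^ b) M (mat 1) \<Longrightarrow> M \<in> B"
    using open_mat2_contains[OF AB(2,4)] by blast
  have "(x, y) \<in> G" if "x \<in> cong_subgroup (a + b)" "y \<in> cong_subgroup (a + b)" for x y
  proof -
    have "x \<in> A"
      using that(1) a mat2_cong_le[of "a + b" x "mat 1" a] by (simp add: mem_cong_subgroup)
    moreover have "y \<in> B"
      using that(2) b mat2_cong_le[of "a + b" y "mat 1" b] by (simp add: mem_cong_subgroup)
    ultimately show ?thesis
      using that AB(5) T(2) by (auto simp: mem_cong_subgroup)
  qed
  then show ?thesis
    unfolding cong_subgroup2_def by blast
qed

section \<open>A gap between the traces\<close>

text \<open>
  Expanding \<open>det (1 + 2\<^sup>j X) = 1\<close> shows that the trace of \<open>X\<close> is itself divisible by \<open>2\<^sup>j\<close>;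
  this is why the exponent doubles.
\<close>
lemma trace_near_two:
  assumes "g \<in> cong_subgroup j"
  shows "2 ^ (2 * j) dvd trace g - 2"
proof -
  obtain X where X: "g = mat 1 + mat2_scale (2 ^ j) X"
    using assms by (rule cong_subgroup_nearE)
  have "1 + 2 ^ j * trace X + 2 ^ j * 2 ^ j * det X = 1"
    using assms unfolding X mem_cong_subgroup det_one_plus_scale by simp
  then have "2 ^ j * trace X = - (2 ^ j * 2 ^ j * det X)"
    by (simp add: add.assoc add_eq_0_iff2)
  moreover have "trace g - 2 = 2 ^ j * trace X"
    unfolding X by (simp add: trace_mat2 mat_nth algebra_simps)
  ultimately show ?thesis
    by (simp add: mult_2 power_add mult.assoc)
qed

text \<open>
  The difference of the trace forms of the two factors. It vanishes identically on the
  graph of the conjugation by a fixed matrix, so it detects that \<open>\<L>(G)\<close> is not contained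
  in such a graph.
\<close>
definition trace_form :: "mat2 \<times> mat2 \<Rightarrow> mat2 \<times> mat2 \<Rightarrow> zadic2" where
  "trace_form u v = trace (fst u ** fst v) - trace (snd u ** snd v)"

text \<open>
  Because \<open>tr(\<Theta>(g) \<Theta>(h)) = tr(g h) - tr(g) tr(h) / 2\<close>, the trace form on \<open>\<Theta>\<^sub>2(G)\<close> only
  depends on traces of elements of \<open>G\<close>. The halving costs no power of 2 since both traces
  in the product are even.
\<close>
lemma trace_form_Theta2:
  assumes g: "mat2_cong 4 g1 (mat 1)" "mat2_cong 4 g2 (mat 1)"
    and h: "mat2_cong 4 h1 (mat 1)" "mat2_cong 4 h2 (mat 1)"
    and dvd: "m dvd trace g1 - trace g2" "m dvd trace h1 - trace h2"
      "m dvd trace (g1 ** h1) - trace (g2 ** h2)"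
  shows "m dvd trace_form (Theta2 (g1, g2)) (Theta2 (h1, h2))"
proof -
  define a where "a x = trace x div 2" for x :: mat2
  have a: "trace x = 2 * a x" if "mat2_cong 4 x (mat 1)" for x
    using two_times_half_trace[OF that] by (simp add: a_def)
  have theta: "trace (theta x ** theta y) = trace (x ** y) - trace x * a y"
    if "mat2_cong 4 x (mat 1)" "mat2_cong 4 y (mat 1)" for x y
  proof -
    have "trace ((x - mat c) ** (y - mat d)) = trace (x ** y) - c * trace y - d * trace x + 2 * c * d"
      for c d
      by (simp add: mat2_entries algebra_simps)
    then have "trace (theta x ** theta y)
        = trace (x ** y) - a x * trace y - a y * trace x + 2 * a x * a y"
      by (simp add: theta_def a_def[symmetric])
    then show ?thesis using a[OF that(1)] a[OF that(2)] by simp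
  qed
  have "trace_form (Theta2 (g1, g2)) (Theta2 (h1, h2))
      = (trace (g1 ** h1) - trace (g2 ** h2)) - (trace g1 - trace g2) * a h1
        - a g2 * (trace h1 - trace h2)"
    using theta[OF g(1) h(1)] theta[OF g(2) h(2)] a[OF g(2)] a[OF h(1)] a[OF h(2)]
    by (simp add: trace_form_def Theta2_def algebra_simps)
  then show ?thesis
    using dvd by (simp add: dvd_diff)
qed

lemma trace_form_lie_span:
  assumes "\<And>x y. x \<in> G \<Longrightarrow> y \<in> G \<Longrightarrow> m dvd trace_form (Theta2 x) (Theta2 y)"
    and "u \<in> lie_span G" "v \<in> lie_span G"
  shows "m dvd trace_form u v"
proof -
  have subspace: "module.subspace pair_scale {u. m dvd trace_form u v}" for v
  proof (rule module.subspaceI[OF module_pair_scale])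
    fix c u assume "u \<in> {u. m dvd trace_form u v}"
    moreover have "trace_form (pair_scale c u) v = c * trace_form u v"
      by (cases u) (simp add: trace_form_def pair_scale_def mat2_entries algebra_simps)
    ultimately show "pair_scale c u \<in> {u. m dvd trace_form u v}"
      by simp
  next
    fix u u' assume "u \<in> {u. m dvd trace_form u v}" "u' \<in> {u. m dvd trace_form u v}"
    moreover have "trace_form (u + u') v = trace_form u v + trace_form u' v"
      by (simp add: trace_form_def mat2_entries algebra_simps)
    ultimately show "u + u' \<in> {u. m dvd trace_form u v}"
      by simp
  qed (simp add: trace_form_def mat2_entries)
  have sym: "trace_form u v = trace_form v u" for u v
    by (simp add: trace_form_def mat2_entries algebra_simps)
  have extend: "m dvd trace_form u v"
    if "\<And>x. x \<in> G \<Longrightarrow> m dvd trace_form (Theta2 x) v" "u \<in> lie_span G" for u v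
    using module.span_minimal[OF module_pair_scale _ subspace, of "Theta2 ` G" v] that
    unfolding lie_span_def by blast
  have "m dvd trace_form (Theta2 x) v" if "x \<in> G" for x
    using extend[of "Theta2 x" v] assms(1)[OF _ that] assms(3) sym by metis
  then show ?thesis
    using extend assms(2) by blast
qed

text \<open>
  Otherwise the trace form would vanish modulo \<open>2\<^bsup>2k+1\<^esup>\<close> on \<open>\<L>(G)\<close>, although
  \<open>tr(2\<^sup>k E \<cdot> 2\<^sup>k F) = 2\<^bsup>2k\<^esup>\<close>.
\<close>
lemma trace_gap:
  assumes mult: "\<And>g1 g2 h1 h2. (g1, g2) \<in> G \<Longrightarrow> (h1, h2) \<in> G \<Longrightarrow> (g1 ** h1, g2 ** h2) \<in> G"
    and mod4: "trivial_mod4 G"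
    and lie: "mat2_scale (2 ^ k) ` sl2 \<times> mat2_scale (2 ^ k) ` sl2 \<subseteq> lie_span G"
  obtains g1 g2 where "(g1, g2) \<in> G" "\<not> 2 ^ (2 * k + 1) dvd trace g1 - trace g2"
proof -
  have "\<exists>g1 g2. (g1, g2) \<in> G \<and> \<not> 2 ^ (2 * k + 1) dvd trace g1 - trace g2"
  proof (rule ccontr)
    assume "\<nexists>g1 g2. (g1, g2) \<in> G \<and> \<not> 2 ^ (2 * k + 1) dvd trace g1 - trace g2"
    then have all: "2 ^ (2 * k + 1) dvd trace g1 - trace g2" if "(g1, g2) \<in> G" for g1 g2
      using that by blast
    have four: "mat2_cong 4 g1 (mat 1)" "mat2_cong 4 g2 (mat 1)" if "(g1, g2) \<in> G" for g1 g2
      using mod4 that unfolding trivial_mod4_def by blast+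
    have "2 ^ (2 * k + 1) dvd trace_form (Theta2 x) (Theta2 y)" if "x \<in> G" "y \<in> G" for x y
    proof -
      obtain g1 g2 h1 h2 where xy: "x = (g1, g2)" "y = (h1, h2)"
        by (metis surj_pair)
      have "(g1, g2) \<in> G" "(h1, h2) \<in> G"
        using that unfolding xy .
      then show ?thesis
        unfolding xy using four all mult by (intro trace_form_Theta2) blast+
    qed
    moreover have "sl2_e \<in> sl2" "sl2_f \<in> sl2" "0 \<in> sl2"
      by (simp_all add: sl2_def trace_mat2)
    then have "(mat2_scale (2 ^ k) sl2_e, mat2_scale (2 ^ k) 0) \<in> lie_span G"
      "(mat2_scale (2 ^ k) sl2_f, mat2_scale (2 ^ k) 0) \<in> lie_span G"
      using lie by blast+
    ultimately have "2 ^ (2 * k + 1) dvd trace_form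
        (mat2_scale (2 ^ k) sl2_e, mat2_scale (2 ^ k) 0)
        (mat2_scale (2 ^ k) sl2_f, mat2_scale (2 ^ k) 0)"
      by (rule trace_form_lie_span)
    moreover have "trace_form (mat2_scale c sl2_e, mat2_scale c 0)
        (mat2_scale c sl2_f, mat2_scale c 0) = c * c" for c
      by (simp add: trace_form_def mat2_entries)
    ultimately have "(2 :: zadic2) ^ (2 * k + 1) dvd 2 ^ (2 * k)"
      by (simp only: power_add[symmetric] mult_2[symmetric])
    then show False
      unfolding pow2_dvd_pow2_iff by simp
  qed
  then show ?thesis using that by blast
qed

text \<open>
  Both traces are 2 modulo 16, so their sum is 4 modulo 16 and contributes exactly two
  factors of 2.
\<close>
lemma trace_sq_gap:
  assumes "g1 \<in> cong_subgroup 2" "g2 \<in> cong_subgroup 2" "\<not> 2 ^ r dvd trace g1 - trace g2"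
  shows "\<not> 2 ^ (r + 2) dvd (trace g1)\<^sup>2 - (trace g2)\<^sup>2"
proof -
  have "\<not> 2 ^ 3 dvd trace g1 + trace g2"
  proof
    assume "2 ^ 3 dvd trace g1 + trace g2"
    moreover have "(2 :: zadic2) ^ 3 dvd 2 ^ (2 * 2)"
      by (rule le_imp_power_dvd) simp
    note dvd_trans[OF this trace_near_two[OF assms(1)]]
      dvd_trans[OF this trace_near_two[OF assms(2)]]
    from dvd_add[OF this] have "2 ^ 3 dvd (trace g1 - 2) + (trace g2 - 2)" .
    ultimately have "2 ^ 3 dvd (trace g1 + trace g2) - ((trace g1 - 2) + (trace g2 - 2))"
      by (rule dvd_diff)
    then have "(2 :: zadic2) ^ 3 dvd 2 ^ 2"
      by (simp add: algebra_simps)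
    then show False
      unfolding pow2_dvd_pow2_iff by simp
  qed
  moreover have "(trace g1)\<^sup>2 - (trace g2)\<^sup>2 = (trace g1 - trace g2) * (trace g1 + trace g2)"
    by (simp add: power2_eq_square algebra_simps)
  ultimately show ?thesis
    using not_pow2_dvd_mult[OF assms(3), of 3 _ "r + 2"] by simp
qed

section \<open>Elements of exact level\<close>

lemma exact_level:
  assumes "g \<in> cong_subgroup s" "g \<notin> cong_subgroup (s + r + 1)"
  obtains e where "s \<le> e" "e \<le> s + r" "g \<in> cong_subgroup e" "g \<notin> cong_subgroup (Suc e)"
proof -
  define e where "e = (LEAST e. g \<notin> cong_subgroup (Suc e) \<and> s \<le> e)"
  have *: "g \<notin> cong_subgroup (Suc (s + r)) \<and> s \<le> s + r"
    using assms(2) by simp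
  have e: "g \<notin> cong_subgroup (Suc e)" "s \<le> e"
    unfolding e_def using LeastI[of "\<lambda>e. g \<notin> cong_subgroup (Suc e) \<and> s \<le> e", OF *] by auto
  have "e \<le> s + r"
    unfolding e_def using * by (rule Least_le)
  moreover have "g \<in> cong_subgroup e"
  proof (cases "e = s")
    case False
    then have "e - 1 < e" "s \<le> e - 1" "Suc (e - 1) = e" using e(2) by auto
    then show ?thesis
      using not_less_Least[of "e - 1" "\<lambda>e. g \<notin> cong_subgroup (Suc e) \<and> s \<le> e"]
      unfolding e_def[symmetric] by auto
  qed (use assms(1) in simp)
  ultimately show ?thesis using that e by blast
qed

lemma square_mem:
  assumes "g \<in> cong_subgroup m" "m \<ge> 1"
  shows "g ** g \<in> cong_subgroup (Suc m)"
proof -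
  obtain Z where Z: "g = mat 1 + mat2_scale (2 ^ m) Z"
    using assms(1) by (rule cong_subgroup_nearE)
  have "near m 1 (g ** g) (Z + Z)"
    using near_mult[OF near_self near_self assms(2)] unfolding Z .
  then have "near m 1 (g ** g) 0"
    by (rule near_cong) (simp add: mat2_cong_def mult_2[symmetric])
  then show ?thesis
    using assms(1) by (simp add: near_def mem_cong_subgroup det_mul mat2_cong_def)
qed

lemma one_plus_e_level:
  assumes "x \<in> cong_subgroup (Suc l)"
  defines "h \<equiv> (mat 1 + mat2_scale (2 ^ l) sl2_e) ** x"
  shows "h \<in> cong_subgroup l" "h \<notin> cong_subgroup (Suc l)"
proof -
  have x: "det x = 1" "mat2_cong (2 ^ Suc l) x (mat 1)"
    using assms by (simp_all add: mem_cong_subgroup)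
  have det: "det h = 1"
    unfolding h_def det_mul x by (simp add: mat2_entries)
  have cong: "mat2_cong (2 ^ Suc l) h (mat 1 + mat2_scale (2 ^ l) sl2_e)"
    unfolding h_def using mat2_cong_mult[OF mat2_cong_refl x(2)] by simp
  then have "near l 1 h sl2_e"
    by (simp add: near_def)
  then show "h \<in> cong_subgroup l"
    using near_imp_mem det by blast
  show "h \<notin> cong_subgroup (Suc l)"
  proof
    assume "h \<in> cong_subgroup (Suc l)"
    then have "mat2_cong (2 ^ Suc l) (mat 1 + mat2_scale (2 ^ l) sl2_e) (mat 1)"
      using mat2_cong_trans[OF mat2_cong_sym[OF cong]] by (simp add: mem_cong_subgroup)
    then have "(2 :: zadic2) ^ Suc l dvd 2 ^ l"
      by (simp add: mat2_cong_iff)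
    then show False
      unfolding pow2_dvd_pow2_iff by simp
  qed
qed

section \<open>The adjoint action on the Lie algebra\<close>

text \<open>
  A matrix that commutes with \<open>E\<close> and \<open>F\<close> modulo \<open>2\<^bsup>r+1\<^esup>\<close> is a scalar \<open>p\<close> modulo \<open>2\<^bsup>r+1\<^esup>\<close>, and
  \<open>p\<^sup>2 = 1\<close> by the determinant. As \<open>p + 1\<close> is 2 modulo 4, it absorbs only one factor of 2
  and \<open>p = 1\<close> modulo \<open>2\<^sup>r\<close>.
\<close>
lemma noncommuting_nilpotent:
  assumes "g \<in> cong_subgroup 2" "g \<notin> cong_subgroup r"
  obtains U where "U \<in> {sl2_e, sl2_f}" "\<not> mat2_cong (2 ^ (r + 1)) (g ** U) (U ** g)"
proof -
  have "\<exists>U\<in>{sl2_e, sl2_f}. \<not> mat2_cong (2 ^ (r + 1)) (g ** U) (U ** g)"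
  proof (rule ccontr)
    assume "\<not> ?thesis"
    then have e: "mat2_cong (2 ^ (r + 1)) (g ** sl2_e) (sl2_e ** g)"
      and f: "mat2_cong (2 ^ (r + 1)) (g ** sl2_f) (sl2_f ** g)"
      by auto
    define p b c d where "p = g $ 1 $ 1" "b = g $ 1 $ 2" "c = g $ 2 $ 1" "d = g $ 2 $ 2"
    note g = p_b_c_d_def[symmetric]
    have dvd: "2 ^ (r + 1) dvd b" "2 ^ (r + 1) dvd c" "2 ^ (r + 1) dvd p - d"
      using e f by (auto simp: mat2_cong_iff mat2_mult_nth g)
    have det: "p * d - b * c = 1" and four: "2 ^ 2 dvd p - 1"
      using assms(1) by (auto simp: mem_cong_subgroup det_2 mat2_cong_iff mat_nth g)
    have "\<not> 2 ^ 2 dvd p + 1"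
    proof
      assume "2 ^ 2 dvd p + 1"
      then have "2 ^ 2 dvd (p + 1) - (p - 1)"
        using four by (rule dvd_diff)
      then have "(2 :: zadic2) ^ 2 dvd 2 ^ 1"
        by simp
      then show False
        unfolding pow2_dvd_pow2_iff by simp
    qed
    moreover have "(p - 1) * (p + 1) = p * (p - d) + b * c"
      using det by (simp add: algebra_simps)
    then have "2 ^ (r + 1) dvd (p - 1) * (p + 1)"
      using dvd by simp
    ultimately have p: "2 ^ r dvd p - 1"
      using not_pow2_dvd_mult[of r "p - 1" 2 "p + 1" "r + 1"] by auto
    have r: "2 ^ r dvd b" "2 ^ r dvd c" "2 ^ r dvd p - d"
      using dvd dvd_trans[OF le_imp_power_dvd[of r "r + 1" 2]] by simp_all
    have "2 ^ r dvd (p - 1) - (p - d)"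
      using p r(3) by (rule dvd_diff)
    then have "g \<in> cong_subgroup r"
      using p r assms(1) by (simp add: mem_cong_subgroup mat2_cong_iff mat_nth g)
    then show False using assms(2) by blast
  qed
  then show ?thesis using that by blast
qed

text \<open>
  The eigenvalues of \<open>Ad g\<close> on \<open>\<ss>\<ll>\<^sub>2\<close> are 1 and \<open>\<lambda>\<^bsup>\<plusminus>2\<^esup>\<close>, where \<open>\<lambda>\<^bsup>\<plusminus>1\<^esup>\<close> are those of \<open>g\<close>. The
  image of \<open>Ad g - 1\<close> is annihilated by the remaining factor \<open>T\<^sup>2 - ((tr g)\<^sup>2 - 2) T + 1\<close> of
  the characteristic polynomial. Concretely, every \<open>Y\<close> in that image satisfies
  \<open>g Y = Y g\<^sup>-\<^sup>1\<close>, which turns \<open>Ad g\<close> into right multiplication by \<open>g\<^sup>-\<^sup>2\<close>.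
\<close>
lemma adjoint_eigen_identity:
  fixes g X :: mat2
  assumes "det g = 1"
  defines "Y \<equiv> g ** X ** adj2 g - X"
  shows "g ** (g ** Y ** adj2 g) ** adj2 g + Y
    = mat2_scale ((trace g)\<^sup>2 - 2) (g ** Y ** adj2 g)"
proof -
  define A \<tau> where "A = adj2 g" and "\<tau> = trace g"
  have left: "g ** (g ** Z) = mat2_scale \<tau> (g ** Z) - Z" for Z
  proof -
    have "g ** g = mat2_scale \<tau> g - mat (det g)"
      by (simp add: mat2_eq_iff mat2_entries \<tau>_def algebra_simps)
    then have "g ** g ** Z = (mat2_scale \<tau> g - mat 1) ** Z"
      by (simp add: assms(1))
    then show ?thesis
      by (simp add: matrix_mul_assoc mat2_diff_mult mat2_scale_mult)
  qed
  have right: "Z ** A ** A = mat2_scale \<tau> (Z ** A) - Z" for Z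
  proof -
    have "A ** A = mat2_scale \<tau> A - mat (det g)"
      by (simp add: mat2_eq_iff mat2_entries \<tau>_def A_def algebra_simps)
    then have "Z ** (A ** A) = Z ** (mat2_scale \<tau> A - mat 1)"
      by (simp add: assms(1))
    also have "\<dots> = mat2_scale \<tau> (Z ** A) - Z"
      by (simp add: mat2_eq_iff mat2_entries algebra_simps)
    finally show ?thesis by (simp add: matrix_mul_assoc)
  qed
  have intertwine: "g ** Y = Y ** A"
  proof -
    have "g ** Y = g ** (g ** (X ** A)) - g ** X"
      by (simp add: Y_def A_def[symmetric] mult_mat2_diff matrix_mul_assoc)
    also have "\<dots> = g ** X ** A ** A - X ** A"
      unfolding left right by (simp add: matrix_mul_assoc algebra_simps)
    also have "\<dots> = Y ** A"
      by (simp add: Y_def A_def[symmetric] mat2_diff_mult)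
    finally show ?thesis .
  qed
  have "g ** (g ** Y ** A) ** A = Y ** A ** A ** A ** A"
    by (simp add: intertwine matrix_mul_assoc)
  also have "\<dots> + Y = mat2_scale (\<tau>\<^sup>2 - 2) (Y ** A ** A)"
    unfolding right mat2_diff_mult mat2_scale_mult
    by (simp add: mat2_eq_iff power2_eq_square algebra_simps)
  also have "Y ** A ** A = g ** Y ** A"
    unfolding intertwine ..
  finally show ?thesis
    unfolding A_def \<tau>_def .
qed

section \<open>Subgroups of a product with large projections\<close>

text \<open>
  For \<open>K = {1}\<close> this is the kernel of the second projection of \<open>G\<close>; taking \<open>K = B(t)\<close>
  gives approximations of that kernel.
\<close>
definition fibre :: "(mat2 \<times> mat2) set \<Rightarrow> mat2 set \<Rightarrow> mat2 set" where
  "fibre G K = {x. \<exists>y\<in>K. (x, y) \<in> G}"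

lemma mem_swap_image: "(a, b) \<in> prod.swap ` G \<longleftrightarrow> (b, a) \<in> G"
  by force

text \<open>
  The pairs of leading terms at level \<open>s\<close> of \<open>G \<inter> (B(s) \<times> B(s))\<close>, with the maximal
  precision \<open>s\<close> for which multiplication is still additive.
\<close>
definition pair_layer :: "(mat2 \<times> mat2) set \<Rightarrow> nat \<Rightarrow> (mat2 \<times> mat2) set" where
  "pair_layer G s = {(Z1, Z2). \<exists>q1 q2. (q1, q2) \<in> G \<and> near s s q1 Z1 \<and> near s s q2 Z2}"

text \<open>
  The hypotheses on \<open>G\<close> that are symmetric under exchanging the factors, with openness
  expressed by a congruence subgroup contained in \<open>G\<close>.
\<close>
locale large_projections =
  fixes G :: "(mat2 \<times> mat2) set" and n1 n2 :: nat
  assumes subgroup: "subgroup G (SL2 \<times>\<times> SL2)"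
    and contains_level: "\<exists>N. cong_subgroup2 N N \<subseteq> G"
    and mod4: "trivial_mod4 G"
    and n1: "n1 \<ge> 3" and fst_large: "cong_subgroup n1 \<subseteq> fst ` G"
    and n2: "n2 \<ge> 3" and snd_large: "cong_subgroup n2 \<subseteq> snd ` G"
begin

lemma det_eq_1: "(g1, g2) \<in> G \<Longrightarrow> det g1 = 1" "(g1, g2) \<in> G \<Longrightarrow> det g2 = 1"
  using subgroup.mem_carrier[OF subgroup] by force+

lemma mult_closed: "(g1, g2) \<in> G \<Longrightarrow> (h1, h2) \<in> G \<Longrightarrow> (g1 ** h1, g2 ** h2) \<in> G"
  using subgroup.m_closed[OF subgroup, of "(g1, g2)" "(h1, h2)"] by simp

lemma adj2_closed: "(g1, g2) \<in> G \<Longrightarrow> (adj2 g1, adj2 g2) \<in> G"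
  using subgroup.m_inv_closed[OF subgroup, of "(g1, g2)"] det_eq_1
  by (simp add: inv_DirProd[OF group_SL2 group_SL2])

lemma one_mem: "(mat 1, mat 1) \<in> G"
  using subgroup.one_closed[OF subgroup] by simp

lemma conj_closed: "(g1, g2) \<in> G \<Longrightarrow> (h1, h2) \<in> G \<Longrightarrow>
    (g1 ** h1 ** adj2 g1, g2 ** h2 ** adj2 g2) \<in> G"
  using mult_closed adj2_closed by blast

lemma mem_level_2: "(g1, g2) \<in> G \<Longrightarrow> g1 \<in> cong_subgroup 2"
  "(g1, g2) \<in> G \<Longrightarrow> g2 \<in> cong_subgroup 2"
  using mod4 det_eq_1 unfolding trivial_mod4_def mem_cong_subgroup by fastforce+

lemma swap: "large_projections (prod.swap ` G) n2 n1"
proof (rule large_projections.intro)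
  note mem = mem_swap_image
  show "subgroup (prod.swap ` G) (SL2 \<times>\<times> SL2)"
  proof (rule group.subgroupI[OF DirProd_group[OF group_SL2 group_SL2]])
    show "prod.swap ` G \<subseteq> carrier (SL2 \<times>\<times> SL2)"
      using det_eq_1 by auto
    show "prod.swap ` G \<noteq> {}"
      using one_mem by blast
    fix a assume a: "a \<in> prod.swap ` G"
    then show "inv\<^bsub>SL2 \<times>\<times> SL2\<^esub> a \<in> prod.swap ` G"
      using adj2_closed det_eq_1 by (cases a) (simp add: mem inv_DirProd[OF group_SL2 group_SL2])
    fix b assume "b \<in> prod.swap ` G"
    with a show "a \<otimes>\<^bsub>SL2 \<times>\<times> SL2\<^esub> b \<in> prod.swap ` G"
      using mult_closed by (cases a, cases b) (simp add: mem)
  qed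
  show "\<exists>N. cong_subgroup2 N N \<subseteq> prod.swap ` G"
    using contains_level by (auto simp: cong_subgroup2_def mem subset_iff)
  show "trivial_mod4 (prod.swap ` G)"
    using mod4 by (auto simp: trivial_mod4_def)
  show "cong_subgroup n2 \<subseteq> fst ` prod.swap ` G" "cong_subgroup n1 \<subseteq> snd ` prod.swap ` G"
    using fst_large snd_large by (auto simp: image_image)
qed (rule n1 n2)+

text \<open>
  A fibre over a normal subgroup is normalised by the whole first projection of \<open>G\<close>, in
  particular by \<open>B(n1)\<close>, so that \<open>normal_closure_contains\<close> applies to it.
\<close>
lemma fibre_contains:
  assumes K: "K \<lhd> SL2"
    and x: "x \<in> fibre G K" "x \<in> cong_subgroup e" "x \<notin> cong_subgroup (Suc e)" and e: "e \<ge> 3"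
  shows "cong_subgroup (e + 2 * n1 + 2) \<subseteq> fibre G K"
proof -
  have subK: "subgroup K SL2" using K by (rule normal_imp_subgroup)
  have K_one: "mat 1 \<in> K" using subgroup.one_closed[OF subK] by simp
  have Q: "subgroup (fibre G K) SL2"
  proof (rule group.subgroupI[OF group_SL2])
    show "fibre G K \<subseteq> carrier SL2"
      using det_eq_1 by (auto simp: fibre_def)
    show "fibre G K \<noteq> {}"
      using one_mem K_one by (auto simp: fibre_def)
    fix a assume a: "a \<in> fibre G K"
    then show "inv\<^bsub>SL2\<^esub> a \<in> fibre G K"
      using adj2_closed det_eq_1 subgroup_SL2_adj2[OF subK] by (fastforce simp: fibre_def)
    fix b assume "b \<in> fibre G K"
    with a show "a \<otimes>\<^bsub>SL2\<^esub> b \<in> fibre G K"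
      using mult_closed subgroup_SL2_mult[OF subK] by (fastforce simp: fibre_def)
  qed
  obtain N where "cong_subgroup2 N N \<subseteq> G"
    using contains_level by blast
  moreover have "mat 1 \<in> cong_subgroup N"
    by (simp add: mem_cong_subgroup)
  ultimately have "cong_subgroup N \<subseteq> fibre G K"
    using K_one unfolding fibre_def cong_subgroup2_def by blast
  moreover have "u ** q ** adj2 u \<in> fibre G K" if u_q: "u \<in> cong_subgroup n1" "q \<in> fibre G K" for u q
  proof -
    obtain u2 where u: "(u, u2) \<in> G"
      using fst_large u_q(1) by force
    obtain q2 where q: "q2 \<in> K" "(q, q2) \<in> G"
      using u_q(2) unfolding fibre_def by blast
    have "u2 ** q2 ** adj2 u2 \<in> K"
      using normal.inv_op_closed2[OF K _ q(1), of u2] det_eq_1[OF u] by simp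
    then show ?thesis
      using conj_closed[OF u q(2)] unfolding fibre_def by blast
  qed
  ultimately show ?thesis
    using normal_closure_contains[OF Q _ n1 _ x e] by blast
qed

text \<open>
  Squaring \<open>r\<close> times an element of \<open>G\<close> with first coordinate \<open>1 + 2\<^bsup>n1\<^esup> U\<close> keeps the first
  coordinate explicit and raises the level of the second coordinate, initially at least 2,
  by \<open>r\<close>.
\<close>
lemma unipotent_ladder:
  assumes U: "U \<in> nilpotents"
  obtains y where "(mat 1 + mat2_scale (2 ^ (n1 + r)) U, y) \<in> G" "y \<in> cong_subgroup (r + 2)"
proof -
  have "\<exists>y. (mat 1 + mat2_scale (2 ^ (n1 + r)) U, y) \<in> G \<and> y \<in> cong_subgroup (r + 2)"
  proof (induction r)
    case 0
    have "mat 1 + mat2_scale (2 ^ n1) U \<in> cong_subgroup n1"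
      using det_one_plus_nilpotent[OF U] by (intro near_imp_mem[OF _ near_self])
    then obtain y where "(mat 1 + mat2_scale (2 ^ n1) U, y) \<in> G"
      using fst_large by force
    then show ?case using mem_level_2(2) by (auto simp: numeral_2_eq_2)
  next
    case (Suc r)
    then obtain y where y: "(mat 1 + mat2_scale (2 ^ (n1 + r)) U, y) \<in> G"
      "y \<in> cong_subgroup (r + 2)"
      by blast
    have "U ** U = 0"
      using nilpotent_square[OF U] .
    then have "(mat 1 + mat2_scale c U) ** (mat 1 + mat2_scale c U) = mat 1 + mat2_scale (2 * c) U"
      for c
      unfolding mat2_eq_iff
      by (simp add: mat2_entries algebra_simps) (simp add: mat2_eq_iff mat2_entries algebra_simps flip: distrib_left)
    then show ?case
      using mult_closed[OF y(1) y(1)] square_mem[OF y(2)] by auto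
  qed
  then show ?thesis using that by blast
qed

lemma pair_layerI:
  "(q1, q2) \<in> G \<Longrightarrow> near s s q1 Z1 \<Longrightarrow> near s s q2 Z2 \<Longrightarrow> (Z1, Z2) \<in> pair_layer G s"
  unfolding pair_layer_def by blast

lemma pair_layerE:
  assumes "(Z1, Z2) \<in> pair_layer G s"
  obtains q1 q2 where "(q1, q2) \<in> G" "near s s q1 Z1" "near s s q2 Z2"
  using assms unfolding pair_layer_def by blast

lemma pair_layer_add:
  assumes "(Z1, Z2) \<in> pair_layer G s" "(W1, W2) \<in> pair_layer G s"
  shows "(Z1 + W1, Z2 + W2) \<in> pair_layer G s"
proof -
  obtain q1 q2 where q: "(q1, q2) \<in> G" "near s s q1 Z1" "near s s q2 Z2"
    using assms(1) by (rule pair_layerE)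
  obtain r1 r2 where r: "(r1, r2) \<in> G" "near s s r1 W1" "near s s r2 W2"
    using assms(2) by (rule pair_layerE)
  show ?thesis
    using mult_closed[OF q(1) r(1)] near_mult[OF q(2) r(2) order_refl] near_mult[OF q(3) r(3) order_refl]
    by (rule pair_layerI)
qed

lemma pair_layer_uminus:
  assumes "(Z1, Z2) \<in> pair_layer G s"
  shows "(- Z1, - Z2) \<in> pair_layer G s"
proof -
  obtain q1 q2 where q: "(q1, q2) \<in> G" "near s s q1 Z1" "near s s q2 Z2"
    using assms by (rule pair_layerE)
  show ?thesis
    using adj2_closed[OF q(1)] near_adj2[OF det_eq_1(1)[OF q(1)] q(2) order_refl]
      near_adj2[OF det_eq_1(2)[OF q(1)] q(3) order_refl]
    by (rule pair_layerI)
qed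

lemma pair_layer_conj:
  assumes g: "(g1, g2) \<in> G" and "(Z1, Z2) \<in> pair_layer G s"
  shows "(g1 ** Z1 ** adj2 g1, g2 ** Z2 ** adj2 g2) \<in> pair_layer G s"
proof -
  obtain q1 q2 where q: "(q1, q2) \<in> G" "near s s q1 Z1" "near s s q2 Z2"
    using assms(2) by (rule pair_layerE)
  show ?thesis
    using conj_closed[OF g q(1)] near_conj[OF det_eq_1(1)[OF g] q(2)] near_conj[OF det_eq_1(2)[OF g] q(3)]
    by (rule pair_layerI)
qed

lemma pair_layer_scale_nat:
  assumes "(Z1, Z2) \<in> pair_layer G s"
  shows "(mat2_scale (of_nat c) Z1, mat2_scale (of_nat c) Z2) \<in> pair_layer G s"
proof (induction c)
  case 0
  have "mat2_scale 0 Z = 0" for Z by (simp add: vec_eq_iff)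
  then show ?case using pair_layerI[OF one_mem near_one near_one] by simp
next
  case (Suc c)
  have "mat2_scale (of_nat (Suc c)) Z = Z + mat2_scale (of_nat c) Z" for Z
    by (simp add: vec_eq_iff algebra_simps)
  then show ?case using pair_layer_add[OF assms Suc] by simp
qed

text \<open>
  The polynomial \<open>(T - 1) (T\<^sup>2 + c T + 1)\<close> applied to the adjoint action of \<open>(g\<^sub>1, g\<^sub>2)\<close>. By
  \<open>adjoint_eigen_identity\<close> it acts on the \<open>i\<close>-th coordinate as \<open>(tr g\<^sub>i)\<^sup>2 - 2 + c\<close> times
  \<open>Ad g\<^sub>i (Ad g\<^sub>i - 1)\<close>; a suitable \<open>c\<close> makes this vanish on one coordinate.
\<close>
lemma pair_layer_char_poly:
  assumes g: "(g1, g2) \<in> G" and Z: "(Z1, Z2) \<in> pair_layer G s"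
  defines "Y1 \<equiv> g1 ** Z1 ** adj2 g1 - Z1" and "Y2 \<equiv> g2 ** Z2 ** adj2 g2 - Z2"
  shows "(mat2_scale ((trace g1)\<^sup>2 - 2 + of_nat c) (g1 ** Y1 ** adj2 g1),
    mat2_scale ((trace g2)\<^sup>2 - 2 + of_nat c) (g2 ** Y2 ** adj2 g2)) \<in> pair_layer G s"
proof -
  have Y: "(Y1, Y2) \<in> pair_layer G s"
    using pair_layer_add[OF pair_layer_conj[OF g Z] pair_layer_uminus[OF Z]]
    by (simp add: Y1_def Y2_def)
  note gY = pair_layer_conj[OF g Y]
  have "mat2_scale ((trace g)\<^sup>2 - 2 + of_nat c) W
      = g ** W ** adj2 g + Y + mat2_scale (of_nat c) W"
    if "det g = 1" "Y = g ** Z ** adj2 g - Z" "W = g ** Y ** adj2 g" for g Y W Z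
  proof -
    have "g ** W ** adj2 g + Y = mat2_scale ((trace g)\<^sup>2 - 2) W"
      using adjoint_eigen_identity[OF that(1), of Z] unfolding that(2,3) .
    then show ?thesis by (simp add: vec_eq_iff algebra_simps)
  qed
  then show ?thesis
    using pair_layer_add[OF pair_layer_add[OF pair_layer_conj[OF g gY] Y] pair_layer_scale_nat[OF gY, of c]]
      det_eq_1[OF g] Y1_def Y2_def by simp
qed

text \<open>
  Separation of the coordinates. The level of \<open>w1\<close> exceeds \<open>s\<close> by at most the sum of three
  losses: \<open>n1 - 2\<close> for the starting vector \<open>2\<^bsup>n1-2\<^esup> U\<close>, at most \<open>2 k + 2\<close> for the factor
  \<open>(tr g1)\<^sup>2 - (tr g2)\<^sup>2\<close>, and at most \<open>k + 1\<close> for the commutator of \<open>g1\<close> and \<open>U\<close>.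
\<close>
lemma deep_element:
  assumes g: "(g1, g2) \<in> G" "g1 \<notin> cong_subgroup (k + 1)"
      "\<not> 2 ^ (2 * k + 1) dvd trace g1 - trace g2"
    and s: "s \<ge> 3 * k + n1 + 2"
  obtains w1 w2 where "(w1, w2) \<in> G" "w1 \<in> cong_subgroup s"
    "w1 \<notin> cong_subgroup (s + (3 * k + n1 + 1) + 1)" "w2 \<in> cong_subgroup (2 * s)"
proof -
  note det_g = det_eq_1[OF g(1)]
  obtain U where U: "U \<in> {sl2_e, sl2_f}" "\<not> mat2_cong (2 ^ (k + 1 + 1)) (g1 ** U) (U ** g1)"
    using noncommuting_nilpotent[OF mem_level_2(1)[OF g(1)] g(2)] .
  have "U \<in> nilpotents"
    using U(1) unfolding nilpotents_def by blast
  then obtain y where y: "(mat 1 + mat2_scale (2 ^ (n1 + (s - 2))) U, y) \<in> G"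
    "y \<in> cong_subgroup (s - 2 + 2)"
    by (rule unipotent_ladder)
  have ns: "n1 + (s - 2) = s + (n1 - 2)" "s - 2 + 2 = s"
    using n1 s by auto
  obtain Z2 where Z2: "y = mat 1 + mat2_scale (2 ^ s) Z2"
    using y(2) unfolding ns by (rule cong_subgroup_nearE)
  define Z1 where "Z1 = mat2_scale (2 ^ (n1 - 2)) U"
  have "mat2_scale (2 ^ (n1 + (s - 2))) U = mat2_scale (2 ^ s) Z1"
    unfolding ns by (simp add: Z1_def vec_eq_iff power_add)
  then have Z: "(Z1, Z2) \<in> pair_layer G s"
    using pair_layerI[OF _ near_self near_self] y(1) Z2 by simp
  \<comment> \<open>with this \<open>c\<close> the polynomial \<open>T\<^sup>2 + c T + 1\<close> annihilates the image of \<open>Ad g2 - 1\<close> modulo \<open>2\<^sup>s\<close>\<close>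
  obtain c where c: "2 ^ s dvd ((trace g2)\<^sup>2 - 2) + of_nat c"
    using ex_nat_pow2_dvd_add by blast
  define Y1 where "Y1 = g1 ** Z1 ** adj2 g1 - Z1"
  define D where "D = (trace g1)\<^sup>2 - 2 + of_nat c"
  obtain w1 w2 where w: "(w1, w2) \<in> G" "near s s w1 (mat2_scale D (g1 ** Y1 ** adj2 g1))"
    "near s s w2 (mat2_scale ((trace g2)\<^sup>2 - 2 + of_nat c)
      (g2 ** (g2 ** Z2 ** adj2 g2 - Z2) ** adj2 g2))"
    using pair_layer_char_poly[OF g(1) Z, of c] unfolding Y1_def D_def by (rule pair_layerE)
  have "near s s w2 0"
    using w(3) by (rule near_cong) (use c in \<open>simp add: mat2_cong_def\<close>)
  then have w2: "w2 \<in> cong_subgroup (2 * s)"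
    using det_eq_1(2)[OF w(1)] by (simp add: near_def mem_cong_subgroup mult_2 mat2_cong_def)
  have w1: "w1 \<in> cong_subgroup s"
    using near_imp_mem[OF det_eq_1(1)[OF w(1)] w(2)] .
  have "\<not> 2 ^ (2 * k + 3) dvd D"
  proof
    assume "2 ^ (2 * k + 3) dvd D"
    moreover have "2 ^ (2 * k + 3) dvd (trace g2)\<^sup>2 - 2 + of_nat c"
      using dvd_trans[OF le_imp_power_dvd c] s n1 by simp
    ultimately have "2 ^ (2 * k + 3) dvd D - ((trace g2)\<^sup>2 - 2 + of_nat c)"
      by (rule dvd_diff)
    moreover have "D - ((trace g2)\<^sup>2 - 2 + of_nat c) = (trace g1)\<^sup>2 - (trace g2)\<^sup>2"
      by (simp add: D_def)
    moreover have "2 * k + 1 + 2 = 2 * k + 3"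
      by simp
    ultimately show False
      using trace_sq_gap[OF mem_level_2[OF g(1)] g(3)] by metis
  qed
  note D = this
  obtain i j where ij: "\<not> 2 ^ (k + 2) dvd (g1 ** U) $ i $ j - (U ** g1) $ i $ j"
    using U(2) by (auto simp: mat2_cong_def)
  define t where "t = 3 * k + n1 + 2"
  have "w1 \<notin> cong_subgroup (s + t)"
  proof
    assume "w1 \<in> cong_subgroup (s + t)"
    then have "near s t w1 0"
      by (simp add: near_def mem_cong_subgroup mat2_cong_def)
    moreover have "near s t w1 (mat2_scale D (g1 ** Y1 ** adj2 g1))"
      using w(2) mat2_cong_le[of "s + s" _ _ "s + t"] s unfolding near_def t_def by simp
    ultimately have cong: "mat2_cong (2 ^ t) (mat2_scale D (g1 ** Y1 ** adj2 g1)) 0"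
      using near_unique by blast
    \<comment> \<open>strip off the invertible factors around the commutator of \<open>g1\<close> and \<open>U\<close>\<close>
    have "mat2_cong (2 ^ t) (adj2 g1 ** mat2_scale D (g1 ** Y1 ** adj2 g1) ** g1 ** g1)
        (adj2 g1 ** 0 ** g1 ** g1)"
      by (intro mat2_cong_mult cong mat2_cong_refl)
    also have "adj2 g1 ** 0 ** g1 ** g1 = 0"
      by (simp add: mat2_eq_iff mat2_mult_nth)
    also have "adj2 g1 ** mat2_scale D (g1 ** Y1 ** adj2 g1) ** g1 ** g1
        = mat2_scale D (adj2 g1 ** (g1 ** Y1 ** adj2 g1) ** g1 ** g1)"
      by (simp add: mat2_mult_scale mat2_scale_mult)
    also have "adj2 g1 ** (g1 ** Y1 ** adj2 g1) ** g1 ** g1 = Y1 ** g1"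
      using det_g(1) by (simp add: matrix_mul_assoc)
    also have "Y1 ** g1 = g1 ** Z1 - Z1 ** g1"
      using det_g(1) by (simp add: Y1_def mat2_diff_mult)
    also have "\<dots> = mat2_scale (2 ^ (n1 - 2)) (g1 ** U - U ** g1)"
      by (simp add: Z1_def mat2_mult_scale mat2_scale_mult vec_eq_iff algebra_simps)
    finally have "2 ^ t dvd D * (2 ^ (n1 - 2) * (g1 ** U - U ** g1) $ i $ j)"
      unfolding mat2_cong_def by simp
    moreover have "t = (n1 - 2) + (3 * k + 4)"
      using n1 by (simp add: t_def)
    ultimately have "2 ^ ((n1 - 2) + (3 * k + 4)) dvd 2 ^ (n1 - 2) * (D * (g1 ** U - U ** g1) $ i $ j)"
      by (simp only: mult.left_commute)
    then have "2 ^ (3 * k + 4) dvd D * ((g1 ** U) $ i $ j - (U ** g1) $ i $ j)"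
      unfolding pow2_mult_dvd_iff by simp
    then show False
      using not_pow2_dvd_mult[OF D ij, of "3 * k + 4"] by simp
  qed
  then show ?thesis
    using that[OF w(1) w1 _ w2] by (simp add: t_def)
qed

text \<open>
  The bound for the second kernel comes from comparing two elements of \<open>G\<close> with the same
  first coordinate: one whose second coordinate is an explicit unipotent matrix of exact
  level \<open>l\<close>, and one whose second coordinate lies in \<open>B(2s)\<close>. The first kernel is then
  reached by making the second coordinate of an element of \<open>G\<close> so deep that the second
  kernel absorbs it.
\<close>
lemma kernels_contain:
  assumes g: "(g1, g2) \<in> G" "g1 \<notin> cong_subgroup (k + 1)"
      "\<not> 2 ^ (2 * k + 1) dvd trace g1 - trace g2"
  shows "cong_subgroup (6 * k + 6 * n1 + 4 * n2 + 5) \<subseteq> fibre (prod.swap ` G) {mat 1}" (is ?second)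
    and "cong_subgroup (6 * k + 9 * n1 + 4 * n2 + 5) \<subseteq> fibre G {mat 1}" (is ?first)
proof -
  interpret swapped: large_projections "prod.swap ` G" n2 n1
    by (rule swap)
  have e: "sl2_e \<in> nilpotents" by (simp add: nilpotents_def)
  have triv: "{mat 1} \<lhd> SL2"
    using group.one_is_normal[OF group_SL2] by simp
  \<comment> \<open>the least \<open>s\<close> for which the level \<open>l\<close> below is smaller than \<open>2 * s\<close>\<close>
  define s where "s = 3 * k + 3 * n1 + n2 + 2"
  define a where "a = s + (3 * k + n1 + 1) + 2 * n1 + 2"
  define l where "l = n2 + (a - 2)"
  have l: "Suc l = 2 * s" "l + 2 * n2 + 2 = 6 * k + 6 * n1 + 4 * n2 + 5"
    by (simp_all add: l_def a_def s_def)
  have "s \<ge> 3 * k + n1 + 2" by (simp add: s_def)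
  then obtain w1 w2 where w: "(w1, w2) \<in> G" "w1 \<in> cong_subgroup s"
    "w1 \<notin> cong_subgroup (s + (3 * k + n1 + 1) + 1)" "w2 \<in> cong_subgroup (2 * s)"
    by (rule deep_element[OF g])
  obtain d where d: "s \<le> d" "d \<le> s + (3 * k + n1 + 1)" "w1 \<in> cong_subgroup d"
    "w1 \<notin> cong_subgroup (Suc d)"
    using exact_level[OF w(2,3)] .
  have "w1 \<in> fibre G (cong_subgroup (2 * s))"
    using w(1,4) by (auto simp: fibre_def)
  moreover have "3 \<le> d"
    using d(1) n1 by (simp add: s_def)
  ultimately have "cong_subgroup (d + 2 * n1 + 2) \<subseteq> fibre G (cong_subgroup (2 * s))"
    using fibre_contains[OF cong_subgroup_normal _ d(3,4)] by blast
  moreover have "cong_subgroup a \<subseteq> cong_subgroup (d + 2 * n1 + 2)"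
    using d(2) by (intro cong_subgroup_mono) (simp add: a_def)
  ultimately have a: "cong_subgroup a \<subseteq> fibre G (cong_subgroup (2 * s))"
    by blast
  obtain y where "(mat 1 + mat2_scale (2 ^ (n2 + (a - 2))) sl2_e, y) \<in> prod.swap ` G"
      "y \<in> cong_subgroup (a - 2 + 2)"
    using swapped.unipotent_ladder[OF e] .
  moreover have "a - 2 + 2 = a" by (simp add: a_def)
  ultimately have y: "(y, mat 1 + mat2_scale (2 ^ l) sl2_e) \<in> G" "y \<in> cong_subgroup a"
    by (simp_all add: mem_swap_image l_def)
  obtain x where x: "x \<in> cong_subgroup (Suc l)" "(y, x) \<in> G"
    using a y(2) unfolding l(1) fibre_def by blast
  define h where "h = (mat 1 + mat2_scale (2 ^ l) sl2_e) ** adj2 x"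
  have "adj2 x \<in> cong_subgroup (Suc l)"
    using subgroup_SL2_adj2[OF normal_imp_subgroup[OF cong_subgroup_normal]] x(1) .
  then have h: "h \<in> cong_subgroup l" "h \<notin> cong_subgroup (Suc l)"
    unfolding h_def by (rule one_plus_e_level)+
  have "(y ** adj2 y, h) \<in> G"
    unfolding h_def using mult_closed[OF y(1) adj2_closed[OF x(2)]] .
  then have "h \<in> fibre (prod.swap ` G) {mat 1}"
    using det_eq_1(1)[OF y(1)] by (simp add: fibre_def mem_swap_image)
  moreover have "3 \<le> l"
    using n2 by (simp add: l_def a_def)
  ultimately show second: ?second
    using swapped.fibre_contains[OF triv _ h] unfolding l(2) by blast

  define T where "T = 6 * k + 6 * n1 + 4 * n2 + 5"
  define u where "u = mat 1 + mat2_scale (2 ^ (n1 + (T - 2))) sl2_e"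
  obtain z where z: "(u, z) \<in> G" "z \<in> cong_subgroup (T - 2 + 2)"
    unfolding u_def using unipotent_ladder[OF e] .
  have "T - 2 + 2 = T" by (simp add: T_def)
  then have "(mat 1, z) \<in> G"
    using second z(2) unfolding T_def[symmetric] fibre_def by (auto simp: mem_swap_image)
  then have "(u, mat 1) \<in> G"
    using mult_closed[OF z(1) adj2_closed[of "mat 1" z]] det_eq_1(2)[OF z(1)] by simp
  then have "u \<in> fibre G {mat 1}"
    by (simp add: fibre_def)
  moreover have "mat 1 \<in> cong_subgroup (Suc (n1 + (T - 2)))"
    by (simp add: mem_cong_subgroup)
  from one_plus_e_level[OF this]
  have "u \<in> cong_subgroup (n1 + (T - 2))" "u \<notin> cong_subgroup (Suc (n1 + (T - 2)))"
    by (simp_all add: u_def)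
  moreover have "3 \<le> n1 + (T - 2)"
    using n1 by simp
  ultimately have "cong_subgroup (n1 + (T - 2) + 2 * n1 + 2) \<subseteq> fibre G {mat 1}"
    using fibre_contains[OF triv] by blast
  moreover have "n1 + (T - 2) + 2 * n1 + 2 = 6 * k + 9 * n1 + 4 * n2 + 5"
    by (simp add: T_def)
  ultimately show ?first
    by (simp only:)
qed

lemma product_of_kernels:
  assumes "cong_subgroup a \<subseteq> fibre G {mat 1}" "cong_subgroup b \<subseteq> fibre (prod.swap ` G) {mat 1}"
    and "a \<le> a'" "b \<le> b'"
  shows "cong_subgroup2 a' b' \<subseteq> G"
proof -
  have "(x, y) \<in> G" if x: "x \<in> cong_subgroup a'" and y: "y \<in> cong_subgroup b'" for x y
  proof -
    have "(x, mat 1) \<in> G"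
      using x cong_subgroup_mono[OF assms(3)] assms(1) by (auto simp: fibre_def)
    moreover have "(mat 1, y) \<in> G"
      using y cong_subgroup_mono[OF assms(4)] assms(2) by (auto simp: fibre_def mem_swap_image)
    ultimately show ?thesis
      using mult_closed by fastforce
  qed
  then show ?thesis
    unfolding cong_subgroup2_def by blast
qed

end

theorem theorem4p2:
  fixes G :: "(mat2 \<times> mat2) set" and n1 n2 k :: nat
  assumes "subgroup G (SL2 \<times>\<times> SL2)"
    and "openin (top_of_set (carrier (SL2 \<times>\<times> SL2))) G"
    and "trivial_mod4 G"
    and "n1 \<ge> 3" and "cong_subgroup n1 \<subseteq> fst ` G"
    and "n2 \<ge> 3" and "cong_subgroup n2 \<subseteq> snd ` G"
    and "k \<ge> 2"
    and "mat2_scale (2 ^ k) ` sl2 \<times> mat2_scale (2 ^ k) ` sl2 \<subseteq> lie_span G"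
  shows "cong_subgroup2 (6 * (k + 11 * n2 + 5 * n1 + 12)) (6 * (k + 11 * n1 + 5 * n2 + 12)) \<subseteq> G"
proof -
  interpret large_projections G n1 n2
    using assms open_subgroup_contains_level by (intro large_projections.intro)
  interpret swapped: large_projections "prod.swap ` G" n2 n1
    by (rule swap)
  obtain g1 g2 where g: "(g1, g2) \<in> G" "\<not> 2 ^ (2 * k + 1) dvd trace g1 - trace g2"
    using trace_gap[OF mult_closed assms(3,9)] .
  \<comment> \<open>otherwise both traces would be 2 modulo \<open>2\<^bsup>2(k+1)\<^esup>\<close>\<close>
  have "g1 \<notin> cong_subgroup (k + 1) \<or> g2 \<notin> cong_subgroup (k + 1)"
  proof (rule ccontr)
    assume "\<not> ?thesis"
    then have "2 ^ (2 * (k + 1)) dvd (trace g1 - 2) - (trace g2 - 2)"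
      using trace_near_two by (blast intro: dvd_diff)
    then have "2 ^ (2 * (k + 1)) dvd trace g1 - trace g2"
      by simp
    moreover have "(2 :: zadic2) ^ (2 * k + 1) dvd 2 ^ (2 * (k + 1))"
      by (rule le_imp_power_dvd) simp
    ultimately show False
      using g(2) dvd_trans by blast
  qed
  then show ?thesis
  proof
    assume "g1 \<notin> cong_subgroup (k + 1)"
    from kernels_contain[OF g(1) this g(2)] show ?thesis
      by (intro product_of_kernels) auto
  next
    assume g2: "g2 \<notin> cong_subgroup (k + 1)"
    have "(g2, g1) \<in> prod.swap ` G" "\<not> 2 ^ (2 * k + 1) dvd trace g2 - trace g1"
      using g by (simp_all add: mem_swap_image dvd_diff_swap)
    from swapped.kernels_contain[OF this(1) g2 this(2)] show ?thesis
      by (intro product_of_kernels) (auto simp: image_image)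
  qed
qed

end
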